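(* Let $n, m, \ell$ be integers with $n > m > \ell \geq 2$, and let \begin{align*} G &= \langle\, x, y, z \mid x^{2^n} = 1,\ y^{2^m} = 1,\ z^{2^\ell} = 1,\ [y, x] = z,\ [z, x] = z^{-2},\ [z, y] = z^{-2} \,\rangle, \\ H &= \langle\, a, b, c \mid a^{2^n} = 1,\ b^{2^m} = a^{2^m},\ c^{2^\ell} = 1,\ [b, a] = c,\ [c, a] = c^{-2},\ [c, b] = c^{-2} \,\rangle. \end{align*} Then $\mathbb{C}G \cong \mathbb{C}H$ (as $\mathbb{C}$-algebras), but $\mathbb{Q}G \not\cong \mathbb{Q}H$ (as $\mathbb{Q}$-algebras).
   Context: Commutators are $[g,h] = g^{-1}h^{-1}gh$. For a commutative ring $R$ and a group $G$, $RG$ denotes the group algebra of $G$ over $R$. *)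

theory Defs
  imports Complex_Main "HOL-Algebra.Module" "HOL-Algebra.QuotRing"
begin

section \<open>Groups given by generators and relations\<close>

text \<open>
  A word is a list of letters; the letter \<open>(x, True)\<close> stands for the generator \<open>x\<close> and
  \<open>(x, False)\<close> for its formal inverse. The generators are all elements of the type \<open>'a\<close>.
\<close>

type_synonym 'a word = "('a \<times> bool) list"

definition wgen :: "'a \<Rightarrow> 'a word"
  where "wgen x = [(x, True)]"

definition winv :: "'a word \<Rightarrow> 'a word"
  where "winv w = rev (map (\<lambda>(x, e). (x, \<not> e)) w)"

definition wpow :: "'a word \<Rightarrow> nat \<Rightarrow> 'a word"
  where "wpow w k = concat (replicate k w)"

definition wcomm :: "'a word \<Rightarrow> 'a word \<Rightarrow> 'a word"
  where "wcomm g h = winv g @ winv h @ g @ h"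

text \<open>
  A pair \<open>(u, v) \<in> R\<close> is the relation \<open>u = v\<close>. Two words represent the same element of the
  presented group iff they are related by the least congruence that contains \<open>R\<close> and allows
  free cancellation.
\<close>

inductive word_eq :: "('a word \<times> 'a word) set \<Rightarrow> 'a word \<Rightarrow> 'a word \<Rightarrow> bool"
  for R :: "('a word \<times> 'a word) set" where
  refl: "word_eq R w w"
| sym: "word_eq R u v \<Longrightarrow> word_eq R v u"
| trans: "word_eq R u v \<Longrightarrow> word_eq R v w \<Longrightarrow> word_eq R u w"
| append: "word_eq R u u' \<Longrightarrow> word_eq R v v' \<Longrightarrow> word_eq R (u @ v) (u' @ v')"
| cancel: "word_eq R [(x, e), (x, \<not> e)] []"
| rel: "(u, v) \<in> R \<Longrightarrow> word_eq R u v"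

definition word_class :: "('a word \<times> 'a word) set \<Rightarrow> 'a word \<Rightarrow> 'a word set"
  where "word_class R w = {v. word_eq R w v}"

definition presented_group :: "('a word \<times> 'a word) set \<Rightarrow> 'a word set monoid"
  where "presented_group R =
    \<lparr>carrier = range (word_class R),
     monoid.mult = (\<lambda>A B. \<Union>u\<in>A. \<Union>v\<in>B. word_class R (u @ v)),
     monoid.one = word_class R []\<rparr>"

lemma presented_group_simps:
  "carrier (presented_group R) = range (word_class R)"
  "\<one>\<^bsub>presented_group R\<^esub> = word_class R []"
  by (simp_all add: presented_group_def)

lemma word_class_eq_iff: "word_class R u = word_class R v \<longleftrightarrow> word_eq R u v"
proof
  assume "word_class R u = word_class R v"
  then have "v \<in> word_class R u"
    by (simp add: word_class_def word_eq.refl)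
  then show "word_eq R u v"
    by (simp add: word_class_def)
next
  assume "word_eq R u v"
  then have "word_eq R u w \<longleftrightarrow> word_eq R v w" for w
    by (metis word_eq.trans word_eq.sym)
  then show "word_class R u = word_class R v"
    by (simp add: word_class_def)
qed

lemma presented_group_mult:
  "word_class R u \<otimes>\<^bsub>presented_group R\<^esub> word_class R v = word_class R (u @ v)"
proof -
  have "word_class R (u' @ v') = word_class R (u @ v)"
    if "u' \<in> word_class R u" "v' \<in> word_class R v" for u' v'
    using that unfolding word_class_eq_iff
    unfolding word_class_def by (intro word_eq.append) (simp_all add: word_eq.sym)
  moreover have "u \<in> word_class R u" "v \<in> word_class R v"
    by (simp_all add: word_class_def word_eq.refl)
  ultimately have "(\<Union>u'\<in>word_class R u. \<Union>v'\<in>word_class R v. word_class R (u' @ v'))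
      = word_class R (u @ v)"
    by blast
  then show ?thesis
    by (simp add: presented_group_def)
qed

lemma word_eq_winv: "word_eq R (winv w @ w) []"
proof (induction w)
  case Nil
  show ?case by (simp add: winv_def word_eq.refl)
next
  case (Cons p w)
  obtain x e where p: "p = (x, e)" by force
  have "word_eq R ([(x, \<not> e), (x, e)] @ w) ([] @ w)"
    using word_eq.cancel[of R x "\<not> e"] by (intro word_eq.append word_eq.refl) simp
  then have "word_eq R (winv w @ [(x, \<not> e), (x, e)] @ w) (winv w @ w)"
    by (intro word_eq.append word_eq.refl) simp
  then show ?case
    using Cons.IH word_eq.trans[of R "winv (p # w) @ p # w" "winv w @ w" "[]"]
    by (simp add: winv_def p)
qed

lemma group_presented_group: "group (presented_group R)"
proof (rule groupI)
  fix A assume "A \<in> carrier (presented_group R)"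
  then obtain w where w: "A = word_class R w"
    by (auto simp: presented_group_def)
  have "word_class R (winv w) \<otimes>\<^bsub>presented_group R\<^esub> A = \<one>\<^bsub>presented_group R\<^esub>"
    unfolding w presented_group_mult
    using word_eq_winv[of R w] by (simp add: presented_group_def word_class_eq_iff)
  then show "\<exists>B\<in>carrier (presented_group R). B \<otimes>\<^bsub>presented_group R\<^esub> A = \<one>\<^bsub>presented_group R\<^esub>"
    by (auto simp: presented_group_def)
qed (auto simp: presented_group_simps presented_group_mult)

definition word_eval :: "('g, 'm) monoid_scheme \<Rightarrow> ('a \<Rightarrow> 'g) \<Rightarrow> 'a word \<Rightarrow> 'g"
  where "word_eval K f w =
    foldr (\<lambda>(x, e) k. (if e then f x else inv\<^bsub>K\<^esub> (f x)) \<otimes>\<^bsub>K\<^esub> k) w \<one>\<^bsub>K\<^esub>"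

lemma word_eval_closed:
  assumes "group K" "\<And>x. f x \<in> carrier K"
  shows "word_eval K f w \<in> carrier K"
proof -
  interpret group K by fact
  show ?thesis by (induction w) (auto simp: word_eval_def assms(2))
qed

lemma word_eval_append:
  assumes "group K" "\<And>x. f x \<in> carrier K"
  shows "word_eval K f (u @ v) = word_eval K f u \<otimes>\<^bsub>K\<^esub> word_eval K f v"
proof -
  interpret group K by fact
  have Nil: "word_eval K f [] = \<one>\<^bsub>K\<^esub>"
    and Cons: "word_eval K f ((x, e) # w) =
      (if e then f x else inv\<^bsub>K\<^esub> (f x)) \<otimes>\<^bsub>K\<^esub> word_eval K f w" for x e w
    by (simp_all add: word_eval_def)
  show ?thesis
    using word_eval_closed[of K f, OF assms]
    by (induction u) (auto simp: Nil Cons assms(2) m_assoc)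
qed

text \<open>Universal property of the presented group.\<close>

lemma presented_group_universal:
  assumes K: "group K" and f: "\<And>x. f x \<in> carrier K"
    and R: "\<And>u v. (u, v) \<in> R \<Longrightarrow> word_eval K f u = word_eval K f v"
  shows "\<exists>h\<in>hom (presented_group R) K. \<forall>x. h (word_class R (wgen x)) = f x"
proof -
  interpret group K by fact
  note closed = word_eval_closed[of K f, OF K f]
  note app = word_eval_append[of K f, OF K f]
  have eq: "word_eval K f u = word_eval K f v" if "word_eq R u v" for u v
    using that
    by induction (auto simp: app R, auto simp: word_eval_def f)
  define h where "h A = word_eval K f (SOME w. w \<in> A)" for A
  have h: "h (word_class R w) = word_eval K f w" for w
  proof -
    have "(SOME v. v \<in> word_class R w) \<in> word_class R w"
      by (rule someI[of _ w]) (simp add: word_class_def word_eq.refl)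
    then show ?thesis
      unfolding h_def word_class_def using eq by simp
  qed
  have "h \<in> hom (presented_group R) K"
    by (rule homI) (auto simp: presented_group_simps presented_group_mult h closed app)
  moreover have "h (word_class R (wgen x)) = f x" for x
    by (simp add: h) (simp add: wgen_def word_eval_def f)
  ultimately show ?thesis by blast
qed

section \<open>Group algebras\<close>

text \<open>
  Elements of the group algebra of \<open>G\<close> over the coefficient type \<open>'r\<close> are the finitely
  supported functions \<open>carrier G \<rightarrow> 'r\<close>, extended by zero outside of \<open>carrier G\<close>.
\<close>

definition group_algebra ::
    "'r::comm_ring_1 itself \<Rightarrow> ('g, 'm) monoid_scheme \<Rightarrow> ('r, 'g \<Rightarrow> 'r) module"
  where "group_algebra _ G =
    \<lparr>carrier = {f. finite {x. f x \<noteq> 0} \<and> {x. f x \<noteq> 0} \<subseteq> carrier G},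
     monoid.mult = (\<lambda>f g x. \<Sum>(y, z)\<in>{(y, z). f y \<noteq> 0 \<and> g z \<noteq> 0 \<and> y \<otimes>\<^bsub>G\<^esub> z = x}. f y * g z),
     monoid.one = (\<lambda>x. if x = \<one>\<^bsub>G\<^esub> then 1 else 0),
     ring.zero = (\<lambda>x. 0),
     ring.add = (\<lambda>f g x. f x + g x),
     module.smult = (\<lambda>r f x. r * f x)\<rparr>"

text \<open>
  Isomorphisms of (not necessarily commutative, unital) algebras whose scalars are all
  elements of the type \<open>'r\<close>.
\<close>

definition algebra_iso ::
    "('r, 'a, 'm) module_scheme \<Rightarrow> ('r, 'b, 'n) module_scheme \<Rightarrow> ('a \<Rightarrow> 'b) set"
  where "algebra_iso A B =
    {h \<in> ring_iso A B. \<forall>r. \<forall>x\<in>carrier A. h (r \<odot>\<^bsub>A\<^esub> x) = r \<odot>\<^bsub>B\<^esub> h x}"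

definition is_algebra_iso ::
    "('r, 'a, 'm) module_scheme \<Rightarrow> ('r, 'b, 'n) module_scheme \<Rightarrow> bool"
  where "is_algebra_iso A B \<longleftrightarrow> algebra_iso A B \<noteq> {}"

section \<open>The two families of groups\<close>

datatype gens = Gx | Gy | Gz

text \<open>The generators \<open>Gx, Gy, Gz\<close> play the roles of \<open>x, y, z\<close> in \<open>G\<close> and of \<open>a, b, c\<close> in \<open>H\<close>.\<close>

definition grpG :: "nat \<Rightarrow> nat \<Rightarrow> nat \<Rightarrow> gens word set monoid"
  where "grpG n m l =
    (let x = wgen Gx; y = wgen Gy; z = wgen Gz in presented_group
      {(wpow x (2 ^ n), []),
       (wpow y (2 ^ m), []),
       (wpow z (2 ^ l), []),
       (wcomm y x, z),
       (wcomm z x, winv (wpow z 2)),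
       (wcomm z y, winv (wpow z 2))})"

definition grpH :: "nat \<Rightarrow> nat \<Rightarrow> nat \<Rightarrow> gens word set monoid"
  where "grpH n m l =
    (let a = wgen Gx; b = wgen Gy; c = wgen Gz in presented_group
      {(wpow a (2 ^ n), []),
       (wpow b (2 ^ m), wpow a (2 ^ m)),
       (wpow c (2 ^ l), []),
       (wcomm b a, c),
       (wcomm c a, winv (wpow c 2)),
       (wcomm c b, winv (wpow c 2))})"

end

theory Submission
  imports Defs "HOL-Library.Product_Plus"
begin

text \<open>
  Over the complex numbers, the central unit \<open>a\<^sup>2\<close> of finite order has a square root \<open>V\<close> among its
  polynomials. It is central, \<open>V ^ 2 ^ m = a ^ 2 ^ m\<close>, and hence \<open>x \<mapsto> a\<close>,
  \<open>y \<mapsto> b V a\<^sup>-\<^sup>2\<close>, \<open>z \<mapsto> c\<close> is an isomorphism.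

  Over the rationals, the group algebra of G contains a nonzero idempotent \<open>e\<close> of the form
  \<open>r (p q - q p)\<close> and a central element \<open>u\<close> with \<open>u ^ 2 ^ (n - 1) = - e\<close>: the centre of some
  noncommutative simple component contains a primitive \<open>2 ^ n\<close>-th root of unity. For H this is
  impossible, since the abelian subgroup of index two generated by \<open>a\<^sup>2\<close>, \<open>b\<^sup>2\<close>, \<open>c\<close> and \<open>b a\<close> has
  exponent dividing \<open>2 ^ (n - 1)\<close>, so that the centres of the noncommutative components embed into the
  field of \<open>2 ^ (n - 1)\<close>-th roots of unity.
\<close>

section \<open>Rings of operators\<close>

text \<open>The groups are told apart by the product of their first two generators. In G,
  \<open>(y x) ^ 2 ^ (n - 1)\<close> equals \<open>x ^ 2 ^ (n - 1)\<close>, which is nontrivial; in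
  H the relation \<open>b ^ 2 ^ m = a ^ 2 ^ m\<close> contributes a second such factor, and the
  power becomes \<open>a ^ 2 ^ n = 1\<close>. Accordingly \<open>u\<close> is made from the sum of
  \<open>y x\<close> and its conjugate under \<open>x\<close>, scaled so that its square is
  \<open>x\<^sup>2\<close> on the component of \<open>e\<close>. Over the complex numbers
  \<open>V\<close> absorbs the difference, but its coefficients involve square roots of roots of
  unity.

  The group algebras are records over classes of words, unwieldy for computation. They are therefore
  represented by operators that form a type-class ring, and several representations are followed at
  once by tuples. Faithfulness of the regular representation takes the place of dimension counts, an
  explicit two-dimensional representation shows that \<open>e\<close> does not vanish, and the
  fields of roots of unity are built as a tower of quadratic extensions of the Gaussian
  rationals.\<close>

instantiation prod :: (times, times) times
begin
definition "p * q = (fst p * fst q, snd p * snd q)"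
instance ..
end

instantiation prod :: (one, one) one
begin
definition "1 = (1, 1)"
instance ..
end

instance prod :: (ring_1, ring_1) ring_1
  by standard (auto simp: times_prod_def one_prod_def zero_prod_def algebra_simps)

lemma mult_Pair [simp]: "(a, b) * (c, d) = (a * c, b * d)"
  by (simp add: times_prod_def)

lemma fst_mult [simp]: "fst (p * q) = fst p * fst q"
  and snd_mult [simp]: "snd (p * q) = snd p * snd q"
  and fst_one [simp]: "fst 1 = 1"
  and snd_one [simp]: "snd 1 = 1"
  by (simp_all add: times_prod_def one_prod_def)

lemma fst_power [simp]: "fst (p ^ k) = fst p ^ k"
  and snd_power [simp]: "snd (p ^ k) = snd p ^ k"
  for p :: "'a::ring_1 \<times> 'b::ring_1"
  by (induction k) simp_all

text \<open>Linear endomorphisms of a function space, made a type so that the class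
  \<open>ring_1\<close> and its simplification rules apply. Linearity is what makes
  \<open>a * (b + c)\<close> distribute.\<close>

typedef 'g lend =
  "{T :: ('g \<Rightarrow> complex) \<Rightarrow> 'g \<Rightarrow> complex.
     (\<forall>p q. T (\<lambda>x. p x + q x) = (\<lambda>x. T p x + T q x)) \<and> (\<forall>c p. T (\<lambda>x. c * p x) = (\<lambda>x. c * T p x))}"
  morphisms app Abs_lend
  by (rule exI[of _ id]) simp

setup_lifting type_definition_lend

instantiation lend :: (type) ring_1
begin

lift_definition zero_lend :: "'a lend" is "\<lambda>p x. 0" by simp
lift_definition one_lend :: "'a lend" is "\<lambda>p. p" by simp
lift_definition plus_lend :: "'a lend \<Rightarrow> 'a lend \<Rightarrow> 'a lend" is "\<lambda>S T p x. S p x + T p x"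
  by (auto simp: algebra_simps fun_eq_iff)
lift_definition minus_lend :: "'a lend \<Rightarrow> 'a lend \<Rightarrow> 'a lend" is "\<lambda>S T p x. S p x - T p x"
  by (auto simp: algebra_simps fun_eq_iff)
lift_definition uminus_lend :: "'a lend \<Rightarrow> 'a lend" is "\<lambda>S p x. - S p x"
  by (auto simp: algebra_simps fun_eq_iff)
lift_definition times_lend :: "'a lend \<Rightarrow> 'a lend \<Rightarrow> 'a lend" is "\<lambda>S T p. S (T p)"
  by simp

instance
proof
  fix a b c :: "'a lend"
  show "a * b * c = a * (b * c)" by transfer simp
  show "1 * a = a" by transfer simp
  show "a * 1 = a" by transfer simp
  show "a + b + c = a + (b + c)" by transfer (simp add: algebra_simps)
  show "a + b = b + a" by transfer (simp add: algebra_simps)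
  show "0 + a = a" by transfer simp
  show "- a + a = 0" by transfer simp
  show "a - b = a + - b" by transfer simp
  show "(a + b) * c = a * c + b * c" by transfer simp
  show "a * (b + c) = a * b + a * c" by transfer simp
  show "(0::'a lend) \<noteq> 1"
  proof transfer
    show "(\<lambda>p x. 0) \<noteq> (\<lambda>p::'a \<Rightarrow> complex. p)"
      by (metis zero_neq_one)
  qed
qed

end

lift_definition scal :: "complex \<Rightarrow> 'a lend" is "\<lambda>c p x. c * p x"
  by (auto simp: algebra_simps)

lemma app_add [simp]: "app T (\<lambda>x. p x + q x) = (\<lambda>x. app T p x + app T q x)"
  and app_scale [simp]: "app T (\<lambda>x. c * p x) = (\<lambda>x. c * app T p x)"
  by (transfer, simp)+

lemma app_ring [simp]:
  "app 0 p = (\<lambda>x. 0)" "app 1 p = p" "app (S + T) p = (\<lambda>x. app S p x + app T p x)"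
  "app (S - T) p = (\<lambda>x. app S p x - app T p x)" "app (- S) p = (\<lambda>x. - app S p x)"
  "app (S * T) p = app S (app T p)" "app (scal c) p = (\<lambda>x. c * p x)"
  by (transfer, simp)+

lemma app_zero [simp]: "app T (\<lambda>x. 0) = (\<lambda>x. 0)"
  using app_scale[of T 0 "\<lambda>x. 0"] by simp

lemma app_uminus [simp]: "app T (\<lambda>x. - p x) = (\<lambda>x. - app T p x)"
  using app_scale[of T "- 1" p] by simp

lemma app_diff [simp]: "app T (\<lambda>x. p x - q x) = (\<lambda>x. app T p x - app T q x)"
  using app_add[of T p "\<lambda>x. - q x"] by simp

lemma lend_eqI: "(\<And>p. app S p = app T p) \<Longrightarrow> S = T"
  by (simp add: app_inject[symmetric] fun_eq_iff)

section \<open>Representations of group algebras\<close>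

text \<open>An algebra over \<open>'r\<close>, encoded by its structure map into the centre of a
  type-class ring.\<close>

locale central_scalars =
  fixes sc :: "'r::comm_ring_1 \<Rightarrow> 'e::ring_1"
  assumes sc_add: "sc (r + s) = sc r + sc s"
    and sc_mult: "sc (r * s) = sc r * sc s"
    and sc_1 [simp]: "sc 1 = 1"
    and sc_comm: "sc r * t = t * sc r"
begin

lemma sc_0 [simp]: "sc 0 = 0"
  using sc_add[of 0 0] by simp

lemma sc_uminus: "sc (- r) = - sc r"
  using sc_add[of r "- r"] by (simp add: eq_neg_iff_add_eq_0 add.commute)

lemma sc_sum: "sc (sum f A) = (\<Sum>x\<in>A. sc (f x))"
  by (induction A rule: infinite_finite_induct) (simp_all add: sc_add)

lemma sc_of_nat [simp]: "sc (of_nat k) = of_nat k"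
  by (induction k) (simp_all add: sc_add)

lemma sc_numeral [simp]: "sc (numeral k) = numeral k"
  using sc_of_nat[of "numeral k"] by (simp del: sc_of_nat)

text \<open>The unit and negatives come from the scalars. Membership in every subalgebra containing
  given elements later expresses being a polynomial in them.\<close>

definition subalgebra :: "'e set \<Rightarrow> bool" where
  "subalgebra S \<longleftrightarrow> range sc \<subseteq> S \<and> (\<forall>a\<in>S. \<forall>b\<in>S. a + b \<in> S \<and> a * b \<in> S)"

context
  fixes S assumes S: "subalgebra S"
begin

lemma subalgebra_sc: "sc r \<in> S"
  and subalgebra_add: "a \<in> S \<Longrightarrow> b \<in> S \<Longrightarrow> a + b \<in> S"
  and subalgebra_mult: "a \<in> S \<Longrightarrow> b \<in> S \<Longrightarrow> a * b \<in> S"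
  using S by (auto simp: subalgebra_def)

lemma subalgebra_1: "1 \<in> S"
  using subalgebra_sc[of 1] by simp

lemma subalgebra_0: "0 \<in> S"
  using subalgebra_sc[of 0] by simp

lemma subalgebra_uminus: "a \<in> S \<Longrightarrow> - a \<in> S"
  using subalgebra_mult[OF subalgebra_sc[of "- 1"], of a] by (simp add: sc_uminus)

lemma subalgebra_diff: "a \<in> S \<Longrightarrow> b \<in> S \<Longrightarrow> a - b \<in> S"
  using subalgebra_add[OF _ subalgebra_uminus, of a b] by simp

lemma subalgebra_power: "a \<in> S \<Longrightarrow> a ^ k \<in> S"
  by (induction k) (auto intro: subalgebra_1 subalgebra_mult)

lemma subalgebra_sum: "(\<And>x. x \<in> A \<Longrightarrow> f x \<in> S) \<Longrightarrow> sum f A \<in> S"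
  by (induction A rule: infinite_finite_induct) (auto intro: subalgebra_0 subalgebra_add)

lemmas subalgebra_intros = subalgebra_sc subalgebra_add subalgebra_mult subalgebra_1
  subalgebra_uminus subalgebra_diff subalgebra_power subalgebra_sum

end

lemma subalgebra_commutant: "subalgebra {a. a * t = t * a}"
proof -
  have "(a * b) * t = t * (a * b)" if "a * t = t * a" "b * t = t * b" for a b
    using that by (metis mult.assoc)
  then show ?thesis
    by (auto simp: subalgebra_def sc_comm algebra_simps)
qed

end

text \<open>The images of the formal inverses are supplied separately by \<open>f'\<close>, since a
  ring has no inverse operation.\<close>

definition wev :: "('a \<Rightarrow> 'e::monoid_mult) \<Rightarrow> ('a \<Rightarrow> 'e) \<Rightarrow> 'a word \<Rightarrow> 'e" where
  "wev f f' w = prod_list (map (\<lambda>(x, e). if e then f x else f' x) w)"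

lemma wev_append [simp]: "wev f f' (u @ v) = wev f f' u * wev f f' v"
  and wev_Nil [simp]: "wev f f' [] = 1"
  and wev_Cons [simp]: "wev f f' ((x, e) # w) = (if e then f x else f' x) * wev f f' w"
  by (simp_all add: wev_def)

lemma wev_wpow [simp]: "wev f f' (wpow w k) = wev f f' w ^ k"
  by (induction k) (simp_all add: wpow_def)

locale presented_rep = central_scalars sc
  for sc :: "'r::comm_ring_1 \<Rightarrow> 'e::ring_1" +
  fixes R :: "('a word \<times> 'a word) set" and f f' :: "'a \<Rightarrow> 'e"
  assumes f_f' [simp]: "f x * f' x = 1" and f'_f [simp]: "f' x * f x = 1"
    and wev_rel: "(u, v) \<in> R \<Longrightarrow> wev f f' u = wev f f' v"
begin

lemma wev_eq: "word_eq R u v \<Longrightarrow> wev f f' u = wev f f' v"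
  by (induction rule: word_eq.induct) (auto simp: wev_rel)

definition rho :: "'a word set \<Rightarrow> 'e" where
  "rho A = wev f f' (SOME w. w \<in> A)"

lemma rho_class [simp]: "rho (word_class R w) = wev f f' w"
proof -
  have "(SOME v. v \<in> word_class R w) \<in> word_class R w"
    by (rule someI[of _ w]) (simp add: word_class_def word_eq.refl)
  then show ?thesis
    unfolding rho_def word_class_def using wev_eq by simp
qed

abbreviation "G \<equiv> presented_group R"
abbreviation "GA \<equiv> group_algebra TYPE('r) (presented_group R)"

lemma rho_mult: "A \<in> carrier G \<Longrightarrow> B \<in> carrier G \<Longrightarrow> rho (A \<otimes>\<^bsub>G\<^esub> B) = rho A * rho B"
  by (auto simp: presented_group_simps presented_group_mult)

definition lin :: "('a word set \<Rightarrow> 'r) \<Rightarrow> 'e" where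
  "lin p = (\<Sum>A | p A \<noteq> 0. sc (p A) * rho A)"

lemma lin_eq: "finite S \<Longrightarrow> {A. p A \<noteq> 0} \<subseteq> S \<Longrightarrow> lin p = (\<Sum>A\<in>S. sc (p A) * rho A)"
  unfolding lin_def by (rule sum.mono_neutral_left) auto

lemma carrier_GA: "p \<in> carrier GA \<longleftrightarrow> finite {A. p A \<noteq> 0} \<and> {A. p A \<noteq> 0} \<subseteq> carrier G"
  by (simp add: group_algebra_def)

lemma GA_sum_support:
  assumes "p \<in> carrier GA" "q \<in> carrier GA"
  shows "finite ({A. p A \<noteq> 0} \<union> {A. q A \<noteq> 0})" "{A. p A \<noteq> 0} \<union> {A. q A \<noteq> 0} \<subseteq> carrier G"
  using assms by (auto simp: carrier_GA)

lemma add_closed: "p \<in> carrier GA \<Longrightarrow> q \<in> carrier GA \<Longrightarrow> p \<oplus>\<^bsub>GA\<^esub> q \<in> carrier GA"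
proof -
  assume *: "p \<in> carrier GA" "q \<in> carrier GA"
  have sub: "{A. p A + q A \<noteq> 0} \<subseteq> {A. p A \<noteq> 0} \<union> {A. q A \<noteq> 0}"
    by auto
  show ?thesis
    using GA_sum_support[OF *] finite_subset[OF sub] sub
    by (auto simp: carrier_GA) (auto simp: group_algebra_def)
qed

lemma lin_add:
  assumes "p \<in> carrier GA" "q \<in> carrier GA"
  shows "lin (p \<oplus>\<^bsub>GA\<^esub> q) = lin p + lin q"
proof -
  note fin = GA_sum_support(1)[OF assms]
  have "p \<oplus>\<^bsub>GA\<^esub> q = (\<lambda>A. p A + q A)"
    by (simp add: group_algebra_def)
  moreover have "lin (\<lambda>A. p A + q A) = (\<Sum>A\<in>{A. p A \<noteq> 0} \<union> {A. q A \<noteq> 0}. sc (p A + q A) * rho A)"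
    by (rule lin_eq[OF fin]) auto
  moreover have "lin p = (\<Sum>A\<in>{A. p A \<noteq> 0} \<union> {A. q A \<noteq> 0}. sc (p A) * rho A)"
    by (rule lin_eq[OF fin]) auto
  moreover have "lin q = (\<Sum>A\<in>{A. p A \<noteq> 0} \<union> {A. q A \<noteq> 0}. sc (q A) * rho A)"
    by (rule lin_eq[OF fin]) auto
  ultimately show ?thesis
    by (simp add: sc_add algebra_simps sum.distrib)
qed

lemma smult_closed: "p \<in> carrier GA \<Longrightarrow> r \<odot>\<^bsub>GA\<^esub> p \<in> carrier GA"
proof -
  assume *: "p \<in> carrier GA"
  have sub: "{A. r * p A \<noteq> 0} \<subseteq> {A. p A \<noteq> 0}"
    by auto
  show ?thesis
    using * finite_subset[OF sub] sub
    by (auto simp: carrier_GA) (auto simp: group_algebra_def)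
qed

lemma lin_smult:
  assumes "p \<in> carrier GA"
  shows "lin (r \<odot>\<^bsub>GA\<^esub> p) = sc r * lin p"
proof -
  have "r \<odot>\<^bsub>GA\<^esub> p = (\<lambda>A. r * p A)"
    by (simp add: group_algebra_def)
  moreover have "lin (\<lambda>A. r * p A) = (\<Sum>A | p A \<noteq> 0. sc (r * p A) * rho A)"
    using assms by (intro lin_eq) (auto simp: carrier_GA)
  ultimately show ?thesis
    by (simp add: lin_def sum_distrib_left sc_mult mult.assoc)
qed

lemma mult_support:
  assumes "p \<in> carrier GA" "q \<in> carrier GA"
  shows "{C. (p \<otimes>\<^bsub>GA\<^esub> q) C \<noteq> 0} \<subseteq> (\<lambda>(A, B). A \<otimes>\<^bsub>G\<^esub> B) ` ({A. p A \<noteq> 0} \<times> {A. q A \<noteq> 0})"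
proof
  fix C assume "C \<in> {C. (p \<otimes>\<^bsub>GA\<^esub> q) C \<noteq> 0}"
  then have "(\<Sum>(A, B)\<in>{(A, B). p A \<noteq> 0 \<and> q B \<noteq> 0 \<and> A \<otimes>\<^bsub>G\<^esub> B = C}. p A * q B) \<noteq> 0"
    by (simp add: group_algebra_def)
  then have "{(A, B). p A \<noteq> 0 \<and> q B \<noteq> 0 \<and> A \<otimes>\<^bsub>G\<^esub> B = C} \<noteq> {}"
    by (rule contrapos_nn) (simp only: sum.empty)
  then show "C \<in> (\<lambda>(A, B). A \<otimes>\<^bsub>G\<^esub> B) ` ({A. p A \<noteq> 0} \<times> {A. q A \<noteq> 0})"
    by force
qed

lemma mult_closed:
  assumes "p \<in> carrier GA" "q \<in> carrier GA"
  shows "p \<otimes>\<^bsub>GA\<^esub> q \<in> carrier GA"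
proof -
  interpret group G by (rule group_presented_group)
  have fin: "finite ((\<lambda>(A, B). A \<otimes>\<^bsub>G\<^esub> B) ` ({A. p A \<noteq> 0} \<times> {A. q A \<noteq> 0}))"
    using assms by (auto simp: carrier_GA)
  have "(\<lambda>(A, B). A \<otimes>\<^bsub>G\<^esub> B) ` ({A. p A \<noteq> 0} \<times> {A. q A \<noteq> 0}) \<subseteq> carrier G"
    using assms by (auto simp: carrier_GA)
  then show ?thesis
    using mult_support[OF assms] finite_subset[OF mult_support[OF assms] fin]
    unfolding carrier_GA by blast
qed

text \<open>The coefficients of a convolution are sums over the fibres of the group multiplication;
  \<open>sum.image_gen\<close> reassembles the fibres into the product of the two supports.\<close>

lemma lin_mult:
  assumes p: "p \<in> carrier GA" and q: "q \<in> carrier GA"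
  shows "lin (p \<otimes>\<^bsub>GA\<^esub> q) = lin p * lin q"
proof -
  let ?P = "{A. p A \<noteq> 0}" and ?Q = "{A. q A \<noteq> 0}"
  let ?m = "\<lambda>(A, B). A \<otimes>\<^bsub>G\<^esub> B"
  have fin: "finite (?P \<times> ?Q)"
    using assms by (auto simp: carrier_GA)
  have carr: "A \<in> carrier G" "B \<in> carrier G" if "(A, B) \<in> ?P \<times> ?Q" for A B
    using that assms by (auto simp: carrier_GA)
  have "lin (p \<otimes>\<^bsub>GA\<^esub> q) = (\<Sum>C\<in>?m ` (?P \<times> ?Q). sc ((p \<otimes>\<^bsub>GA\<^esub> q) C) * rho C)"
    using fin mult_support[OF assms] by (intro lin_eq) auto
  also have "\<dots> = (\<Sum>C\<in>?m ` (?P \<times> ?Q). \<Sum>t | t \<in> ?P \<times> ?Q \<and> ?m t = C.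
      (case t of (A, B) \<Rightarrow> sc (p A * q B) * (rho A * rho B)))"
  proof (rule sum.cong[OF HOL.refl])
    fix C
    have "(p \<otimes>\<^bsub>GA\<^esub> q) C = (\<Sum>(A, B)\<in>{t. t \<in> ?P \<times> ?Q \<and> ?m t = C}. p A * q B)"
      by (auto simp: group_algebra_def intro!: sum.cong)
    then have "sc ((p \<otimes>\<^bsub>GA\<^esub> q) C) * rho C
        = (\<Sum>t | t \<in> ?P \<times> ?Q \<and> ?m t = C. sc (case t of (A, B) \<Rightarrow> p A * q B) * rho C)"
      by (simp add: sc_sum sum_distrib_right)
    also have "\<dots> = (\<Sum>t | t \<in> ?P \<times> ?Q \<and> ?m t = C.
      (case t of (A, B) \<Rightarrow> sc (p A * q B) * (rho A * rho B)))"
      by (rule sum.cong) (use carr in \<open>auto simp: rho_mult[symmetric]\<close>)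
    finally show "sc ((p \<otimes>\<^bsub>GA\<^esub> q) C) * rho C = \<dots>" .
  qed
  also have "\<dots> = (\<Sum>(A, B)\<in>?P \<times> ?Q. sc (p A * q B) * (rho A * rho B))"
    by (rule sum.image_gen[OF fin, symmetric])
  also have "\<dots> = (\<Sum>A\<in>?P. \<Sum>B\<in>?Q. (sc (p A) * rho A) * (sc (q B) * rho B))"
    unfolding sum.cartesian_product[symmetric]
    by (intro sum.cong HOL.refl) (metis mult.assoc sc_comm sc_mult)
  also have "\<dots> = lin p * lin q"
    by (simp add: lin_def sum_product)
  finally show ?thesis .
qed

definition basis :: "'a word \<Rightarrow> 'a word set \<Rightarrow> 'r" where
  "basis w = (\<lambda>A. if A = word_class R w then 1 else 0)"

lemma basis_closed: "basis w \<in> carrier GA"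
  by (auto simp: carrier_GA basis_def presented_group_simps)

lemma lin_basis [simp]: "lin (basis w) = wev f f' w"
  by (subst lin_eq[of "{word_class R w}"]) (auto simp: basis_def)

lemma GA_one: "\<one>\<^bsub>GA\<^esub> = basis []"
  by (simp add: group_algebra_def basis_def presented_group_simps)

lemma lin_in_subalgebra:
  assumes S: "subalgebra S" and f: "\<And>x. f x \<in> S" "\<And>x. f' x \<in> S" and "p \<in> carrier GA"
  shows "lin p \<in> S"
proof -
  have "wev f f' w \<in> S" for w
    by (induction w) (auto simp: f subalgebra_mult[OF S] subalgebra_1[OF S])
  then have "rho A \<in> S" for A
    by (simp add: rho_def)
  then show ?thesis
    unfolding lin_def by (intro subalgebra_intros[OF S])
qed

lemma subalgebra_range_lin: "subalgebra (lin ` carrier GA)"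
  unfolding subalgebra_def
proof (intro conjI ballI)
  have "sc r \<in> lin ` carrier GA" for r
  proof
    show "r \<odot>\<^bsub>GA\<^esub> basis [] \<in> carrier GA"
      by (rule smult_closed[OF basis_closed])
    show "sc r = lin (r \<odot>\<^bsub>GA\<^esub> basis [])"
      by (simp add: lin_smult[OF basis_closed])
  qed
  then show "range sc \<subseteq> lin ` carrier GA" by auto
  fix a b assume "a \<in> lin ` carrier GA" "b \<in> lin ` carrier GA"
  then obtain p q where p: "p \<in> carrier GA" "a = lin p" and q: "q \<in> carrier GA" "b = lin q"
    by (elim imageE)
  show "a + b \<in> lin ` carrier GA" "a * b \<in> lin ` carrier GA"
    unfolding p(2) q(2) lin_add[OF p(1) q(1), symmetric] lin_mult[OF p(1) q(1), symmetric]
    by (intro imageI add_closed mult_closed p q)+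
qed

lemma f_in_range_lin: "f x \<in> lin ` carrier GA" "f' x \<in> lin ` carrier GA"
proof -
  have "lin (basis [(x, True)]) = f x" "lin (basis [(x, False)]) = f' x"
    by simp_all
  then show "f x \<in> lin ` carrier GA" "f' x \<in> lin ` carrier GA"
    using basis_closed by (metis image_eqI)+
qed

end

text \<open>Two faithful representations in one ring with the same image: one composed with the
  inverse of the other is the isomorphism. The images agree because each contains the generators of
  the other.\<close>

lemma algebra_iso_of_common_range:
  fixes sc :: "'r::comm_ring_1 \<Rightarrow> 'e::ring_1"
  assumes A: "presented_rep sc R f f'" and B: "presented_rep sc R2 g g'"
    and injA: "inj_on (presented_rep.lin sc f f') (carrier (group_algebra TYPE('r) (presented_group R)))"
    and injB: "inj_on (presented_rep.lin sc g g') (carrier (group_algebra TYPE('r) (presented_group R2)))"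
    and f: "\<And>x. f x \<in> presented_rep.lin sc g g' ` carrier (group_algebra TYPE('r) (presented_group R2))"
      "\<And>x. f' x \<in> presented_rep.lin sc g g' ` carrier (group_algebra TYPE('r) (presented_group R2))"
    and g: "\<And>x. g x \<in> presented_rep.lin sc f f' ` carrier (group_algebra TYPE('r) (presented_group R))"
      "\<And>x. g' x \<in> presented_rep.lin sc f f' ` carrier (group_algebra TYPE('r) (presented_group R))"
  shows "is_algebra_iso (group_algebra TYPE('r) (presented_group R)) (group_algebra TYPE('r) (presented_group R2))"
proof -
  interpret A: presented_rep sc R f f' by fact
  interpret B: presented_rep sc R2 g g' by fact
  note injA = injA[folded A.lin_def] and injB = injB[folded B.lin_def]
  have range: "A.lin ` carrier A.GA = B.lin ` carrier B.GA"
    using A.lin_in_subalgebra[OF B.subalgebra_range_lin f]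
      B.lin_in_subalgebra[OF A.subalgebra_range_lin g] by auto
  define h where "h p = the_inv_into (carrier B.GA) B.lin (A.lin p)" for p
  have h: "h p \<in> carrier B.GA" "B.lin (h p) = A.lin p" if "p \<in> carrier A.GA" for p
    using that range f_the_inv_into_f[OF injB, of "A.lin p"] the_inv_into_into[OF injB, of "A.lin p"]
    by (auto simp: h_def)
  have eqI: "h p = q" if "p \<in> carrier A.GA" "q \<in> carrier B.GA" "A.lin p = B.lin q" for p q
    using that h[of p] injB by (auto dest: inj_onD)
  have "h \<in> algebra_iso A.GA B.GA"
    unfolding algebra_iso_def ring_iso_def
  proof (safe)
    show "h \<in> ring_hom A.GA B.GA"
    proof (rule ring_hom_memI)
      fix p q assume p: "p \<in> carrier A.GA" and q: "q \<in> carrier A.GA"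
      show "h (p \<otimes>\<^bsub>A.GA\<^esub> q) = h p \<otimes>\<^bsub>B.GA\<^esub> h q"
        using h[OF p] h[OF q] by (intro eqI A.mult_closed B.mult_closed p q) (simp_all add: A.lin_mult B.lin_mult p q)
      show "h (p \<oplus>\<^bsub>A.GA\<^esub> q) = h p \<oplus>\<^bsub>B.GA\<^esub> h q"
        using h[OF p] h[OF q] by (intro eqI A.add_closed B.add_closed p q) (simp_all add: A.lin_add B.lin_add p q)
    next
      show "h \<one>\<^bsub>A.GA\<^esub> = \<one>\<^bsub>B.GA\<^esub>"
        unfolding A.GA_one B.GA_one by (intro eqI A.basis_closed B.basis_closed) simp
    qed (rule h)
    show "bij_betw h (carrier A.GA) (carrier B.GA)"
    proof (rule bij_betwI')
      fix p q assume "p \<in> carrier A.GA" "q \<in> carrier A.GA"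
      then show "h p = h q \<longleftrightarrow> p = q"
        using h(2)[of p] h(2)[of q] inj_onD[OF injA, of p q] by auto
    next
      fix q assume q: "q \<in> carrier B.GA"
      then obtain p where p: "p \<in> carrier A.GA" "A.lin p = B.lin q"
        using range by (metis (no_types, lifting) imageE imageI)
      then show "\<exists>p\<in>carrier A.GA. q = h p"
        using eqI[OF p(1) q p(2)] by blast
    qed (rule h)
    show "h (r \<odot>\<^bsub>A.GA\<^esub> p) = r \<odot>\<^bsub>B.GA\<^esub> h p" if "p \<in> carrier A.GA" for r p
      using h[OF that] by (intro eqI A.smult_closed B.smult_closed that) (simp_all add: A.lin_smult B.lin_smult that)
  qed
  then show ?thesis
    by (auto simp: is_algebra_iso_def)
qed

section \<open>The regular representation\<close>

lemma lend_scalars: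
  fixes j :: "'r::comm_ring_1 \<Rightarrow> complex"
  assumes "\<And>r s. j (r + s) = j r + j s" "\<And>r s. j (r * s) = j r * j s" "j 1 = 1"
  shows "central_scalars (\<lambda>r. scal (j r))"
  by unfold_locales (auto intro!: lend_eqI simp: assms distrib_right mult.assoc)

text \<open>Right translation; outside of the group it is the identity, so that the unit acts as 1.\<close>

lift_definition reg :: "('a word \<times> 'a word) set \<Rightarrow> 'a word set \<Rightarrow> 'a word set lend"
  is "\<lambda>R A p X. if X \<in> range (word_class R) then p (X \<otimes>\<^bsub>presented_group R\<^esub> A) else p X"
  by auto

lemma app_reg: "app (reg R A) p X =
    (if X \<in> range (word_class R) then p (X \<otimes>\<^bsub>presented_group R\<^esub> A) else p X)"
  by transfer simp

definition regw :: "('a word \<times> 'a word) set \<Rightarrow> 'a word \<Rightarrow> 'a word set lend" where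
  "regw R w = reg R (word_class R w)"

text \<open>Right translation of functions keeps the order of the factors: applying first
  \<open>v\<close> and then \<open>u\<close> to \<open>p\<close> gives \<open>p (X u v)\<close> at
  \<open>X\<close>.\<close>

lemma regw_append: "regw R (u @ v) = regw R u * regw R v"
  by (rule lend_eqI) (auto simp: regw_def app_reg presented_group_mult fun_eq_iff)

lemma regw_Nil: "regw R [] = 1"
  by (rule lend_eqI) (auto simp: regw_def app_reg presented_group_mult fun_eq_iff)

lemma regw_eq: "word_eq R u v \<Longrightarrow> regw R u = regw R v"
  by (metis regw_def word_class_eq_iff)

abbreviation "regf R x \<equiv> regw R [(x, True)]"
abbreviation "regf' R x \<equiv> regw R [(x, False)]"

lemma wev_regw: "wev (regf R) (regf' R) w = regw R w"
proof (induction w)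
  case (Cons p w)
  obtain x e where p: "p = (x, e)" by force
  show ?case
    using Cons regw_append[of R "[p]" w] by (simp add: p)
qed (simp add: regw_Nil)

text \<open>The embedding \<open>j\<close> of the coefficients lets rational group algebras act on
  complex functions too, where eigenvectors are available.\<close>

locale regular_rep =
  fixes j :: "'r::comm_ring_1 \<Rightarrow> complex" and R :: "('a word \<times> 'a word) set"
  assumes j_add: "j (r + s) = j r + j s" and j_mult: "j (r * s) = j r * j s" and j_1: "j 1 = 1"
    and j_inj: "j r = j s \<Longrightarrow> r = s"
begin

sublocale presented_rep "\<lambda>r. scal (j r)" R "regf R" "regf' R"
proof -
  interpret central_scalars "\<lambda>r. scal (j r)"
    by (rule lend_scalars) (simp_all add: j_add j_mult j_1)
  show "presented_rep (\<lambda>r. scal (j r)) R (regf R) (regf' R)"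
  proof
    show "regf R x * regf' R x = 1" "regf' R x * regf R x = 1" for x
      using regw_eq[OF word_eq.cancel[of R x True]] regw_eq[OF word_eq.cancel[of R x False]]
        regw_append[of R "[(x, True)]" "[(x, False)]"] regw_append[of R "[(x, False)]" "[(x, True)]"]
      by (simp_all add: regw_Nil)
    show "wev (regf R) (regf' R) u = wev (regf R) (regf' R) v" if "(u, v) \<in> R" for u v
      unfolding wev_regw by (rule regw_eq[OF word_eq.rel[OF that]])
  qed
qed

lemma j_0: "j 0 = 0"
  using j_add[of 0 0] by simp

lemma app_sum: "app (sum g S) p = (\<lambda>x. \<Sum>a\<in>S. app (g a) p x)"
  by (induction S rule: infinite_finite_induct) simp_all

text \<open>At the identity, translation by \<open>A\<close> reads the value of a function at
  \<open>A\<close>, so the indicator function of \<open>B\<close> picks out one coefficient.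
  Faithfulness follows.\<close>

lemma lin_coeff:
  assumes p: "p \<in> carrier GA" and B: "B \<in> carrier G"
  shows "app (lin p) (\<lambda>A. if A = B then 1 else 0) (word_class R []) = j (p B)"
proof -
  let ?d = "\<lambda>A. if A = B then 1 else 0 :: complex"
  have rho: "app (rho A) ?d (word_class R []) = ?d A" if "A \<in> carrier G" for A
  proof -
    from that obtain w where w: "A = word_class R w"
      by (auto simp: presented_group_simps)
    show ?thesis
      unfolding w rho_class wev_regw unfolding regw_def app_reg presented_group_mult by simp
  qed
  have "app (lin p) ?d (word_class R []) = (\<Sum>A | p A \<noteq> 0. j (p A) * ?d A)"
    unfolding lin_def app_sum using p by (auto intro!: sum.cong simp: rho carrier_GA)
  also have "\<dots> = (\<Sum>A\<in>insert B {A. p A \<noteq> 0}. j (p A) * ?d A)"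
    using p by (intro sum.mono_neutral_left) (auto simp: carrier_GA j_0)
  also have "\<dots> = j (p B)"
    using p by (subst sum.remove[of _ B]) (auto simp: carrier_GA intro!: sum.neutral)
  finally show ?thesis .
qed

lemma inj_lin: "inj_on lin (carrier GA)"
proof (rule inj_onI)
  fix p q assume p: "p \<in> carrier GA" and q: "q \<in> carrier GA" and eq: "lin p = lin q"
  have "p B = q B" for B
  proof (cases "B \<in> carrier G")
    case True
    then show ?thesis
      using lin_coeff[OF p True] lin_coeff[OF q True] eq by (intro j_inj) simp
  next
    case False
    then have "p B = 0" "q B = 0"
      using p q by (auto simp: carrier_GA)
    then show ?thesis by simp
  qed
  then show "p = q" by blast
qed

lemma basis_append: "basis (u @ v) = basis u \<otimes>\<^bsub>GA\<^esub> basis v"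
  by (rule inj_onD[OF inj_lin]) (simp_all add: lin_mult basis_closed mult_closed)

end

section \<open>The common relations\<close>

text \<open>The commutator relations in conjugation form: \<open>[z, x]\<close> and
  \<open>[z, y]\<close> being \<open>z\<^sup>-\<^sup>2\<close> means that conjugation by
  \<open>x\<close> and by \<open>y\<close> inverts \<open>z\<close>.\<close>

locale gen_rels =
  fixes x x' y y' z z' :: "'e::ring_1"
  assumes inv [simp]: "x * x' = 1" "x' * x = 1" "y * y' = 1" "y' * y = 1" "z * z' = 1" "z' * z = 1"
    and yx: "y * x = x * y * z" and zx: "z * x = x * z'" and zy: "z * y = y * z'"
begin

lemma inv_assoc [simp]: "x * (x' * t) = t" "x' * (x * t) = t" "y * (y' * t) = t" "y' * (y * t) = t"
  "z * (z' * t) = t" "z' * (z * t) = t"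
  by (simp_all add: mult.assoc[symmetric])

lemma z'x: "z' * x = x * z"
  by (metis inv_assoc(5) inv_assoc(6) mult.assoc mult_1_right inv(5) inv(6) zx)

lemma z'y: "z' * y = y * z"
  by (metis inv_assoc(5) inv_assoc(6) mult.assoc mult_1_right inv(5) inv(6) zy)

lemma xy: "x * y = y * (x * z')"
  using yx by (metis inv(5) mult.assoc mult_1_right)

text \<open>Rewrite rules that sort products into the order \<open>y\<close>, \<open>x\<close>,
  \<open>z\<close>; the versions with a trailing \<open>t\<close> act inside right-associated
  products.\<close>

lemma normal_form:
  "z * x = x * z'" "z * y = y * z'" "z' * x = x * z" "z' * y = y * z" "x * y = y * (x * z')"
  "z * (x * t) = x * (z' * t)" "z * (y * t) = y * (z' * t)" "z' * (x * t) = x * (z * t)"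
  "z' * (y * t) = y * (z * t)" "x * (y * t) = y * (x * (z' * t))"
  by (simp_all add: zx zy z'x z'y xy mult.assoc[symmetric])

text \<open>Passing \<open>x\<close> across \<open>y\<close> twice produces \<open>z\<close> and, as
  \<open>x\<close> inverts \<open>z\<close>, then \<open>z'\<close>, which cancel. The same happens
  with \<open>x\<close> and \<open>y\<close> exchanged.\<close>

lemma square_central:
  "x * x * y = y * (x * x)" "x * x * z = z * (x * x)" "y * y * x = x * (y * y)" "y * y * z = z * (y * y)"
  by (simp_all add: normal_form mult.assoc)

text \<open>Commutators do not notice a central unit \<open>V\<close> multiplied to
  \<open>y\<close>; only the power relation for \<open>y\<close> changes. This is how one passes
  between the relations of G and H.\<close>

lemma twist:
  assumes V: "V * x = x * V" "V * y = y * V" "V * z = z * V" and VW: "V * W = 1" "W * V = 1"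
  shows "gen_rels x x' (y * V) (W * y') z z'"
proof
  have V': "V * z' = z' * V"
    by (metis V(3) inv(5) inv_assoc(6) mult.assoc mult_1_right)
  show "y * V * (W * y') = 1" "W * y' * (y * V) = 1"
    by (metis VW inv mult.assoc mult_1_left)+
  show "y * V * x = x * (y * V) * z" by (metis V yx mult.assoc)
  show "z * (y * V) = y * V * z'" by (metis V' zy mult.assoc)
qed (simp_all add: zx)

end

lemma gen_rels_prod:
  assumes "gen_rels x x' y y' z z'" "gen_rels a a' b b' c c'"
  shows "gen_rels (x, a) (x', a') (y, b) (y', b') (z, c) (z', c')"
proof -
  interpret A: gen_rels x x' y y' z z' by fact
  interpret B: gen_rels a a' b b' c c' by fact
  show ?thesis
    by unfold_locales (simp_all add: one_prod_def A.yx B.yx A.zx B.zx A.zy B.zy)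
qed

section \<open>The two presentations as identities between units\<close>

definition comm_rels :: "(gens word \<times> gens word) set" where
  "comm_rels = {(wcomm (wgen Gy) (wgen Gx), wgen Gz),
     (wcomm (wgen Gz) (wgen Gx), winv (wpow (wgen Gz) 2)),
     (wcomm (wgen Gz) (wgen Gy), winv (wpow (wgen Gz) 2))}"

definition relsG :: "nat \<Rightarrow> nat \<Rightarrow> nat \<Rightarrow> (gens word \<times> gens word) set" where
  "relsG n m l = {(wpow (wgen Gx) (2 ^ n), []), (wpow (wgen Gy) (2 ^ m), []), (wpow (wgen Gz) (2 ^ l), [])} \<union> comm_rels"

definition relsH :: "nat \<Rightarrow> nat \<Rightarrow> nat \<Rightarrow> (gens word \<times> gens word) set" where
  "relsH n m l = {(wpow (wgen Gx) (2 ^ n), []), (wpow (wgen Gy) (2 ^ m), wpow (wgen Gx) (2 ^ m)), (wpow (wgen Gz) (2 ^ l), [])} \<union> comm_rels"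

lemma grpG_eq: "grpG n m l = presented_group (relsG n m l)"
  and grpH_eq: "grpH n m l = presented_group (relsH n m l)"
  by (simp_all add: grpG_def grpH_def relsG_def relsH_def comm_rels_def Let_def insert_commute)

abbreviation gen_rels_fun :: "(gens \<Rightarrow> 'e::ring_1) \<Rightarrow> (gens \<Rightarrow> 'e) \<Rightarrow> bool" where
  "gen_rels_fun f f' \<equiv> gen_rels (f Gx) (f' Gx) (f Gy) (f' Gy) (f Gz) (f' Gz)"

lemma wev_wgen [simp]: "wev f f' (wgen x) = f x"
  by (simp add: wgen_def)

lemma wev_comm_rels:
  fixes f f' :: "gens \<Rightarrow> 'e::ring_1"
  shows "(\<forall>(u, v)\<in>comm_rels. wev f f' u = wev f f' v) \<longleftrightarrow>
    f' Gy * f' Gx * f Gy * f Gx = f Gz \<and> f' Gz * f' Gx * f Gz * f Gx = f' Gz * f' Gz \<and>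
    f' Gz * f' Gy * f Gz * f Gy = f' Gz * f' Gz"
  by (simp add: comm_rels_def wcomm_def wgen_def winv_def wpow_def numeral_2_eq_2 mult.assoc)

lemma gen_rels_fun_iff:
  fixes f f' :: "gens \<Rightarrow> 'e::ring_1"
  assumes inv: "\<And>x. f x * f' x = 1" "\<And>x. f' x * f x = 1"
  shows "gen_rels_fun f f' \<longleftrightarrow> (\<forall>(u, v)\<in>comm_rels. wev f f' u = wev f f' v)"
proof -
  have cancel: "f x * (f' x * t) = t" "f' x * (f x * t) = t" for x t
    by (simp_all add: mult.assoc[symmetric] inv)
  have "f' Gy * f' Gx * f Gy * f Gx = f Gz \<longleftrightarrow> f Gy * f Gx = f Gx * f Gy * f Gz"
    by (metis cancel mult.assoc)
  moreover have "f' Gz * f' Gx * f Gz * f Gx = f' Gz * f' Gz \<longleftrightarrow> f Gz * f Gx = f Gx * f' Gz"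
    by (metis cancel mult.assoc)
  moreover have "f' Gz * f' Gy * f Gz * f Gy = f' Gz * f' Gz \<longleftrightarrow> f Gz * f Gy = f Gy * f' Gz"
    by (metis cancel mult.assoc)
  ultimately show ?thesis
    unfolding wev_comm_rels gen_rels_def by (simp add: inv)
qed


lemma presented_rep_relsG_iff:
  fixes f f' :: "gens \<Rightarrow> 'e::ring_1"
  shows "presented_rep sc (relsG n m l) f f' \<longleftrightarrow> central_scalars sc \<and> gen_rels_fun f f' \<and>
    (\<forall>x. f x * f' x = 1 \<and> f' x * f x = 1) \<and>
    f Gx ^ 2 ^ n = 1 \<and> f Gy ^ 2 ^ m = 1 \<and> f Gz ^ 2 ^ l = 1"
  using gen_rels_fun_iff[of f f']
  by (auto simp: presented_rep_def presented_rep_axioms_def relsG_def)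

lemma presented_rep_relsH_iff:
  fixes f f' :: "gens \<Rightarrow> 'e::ring_1"
  shows "presented_rep sc (relsH n m l) f f' \<longleftrightarrow> central_scalars sc \<and> gen_rels_fun f f' \<and>
    (\<forall>x. f x * f' x = 1 \<and> f' x * f x = 1) \<and>
    f Gx ^ 2 ^ n = 1 \<and> f Gy ^ 2 ^ m = f Gx ^ 2 ^ m \<and> f Gz ^ 2 ^ l = 1"
  using gen_rels_fun_iff[of f f']
  by (auto simp: presented_rep_def presented_rep_axioms_def relsH_def)


section \<open>The complex group algebras\<close>

context central_scalars
begin

lemma sc_left_commute: "t * (sc r * u) = sc r * (t * u)"
  by (metis mult.assoc sc_comm)

text \<open>The commutant of \<open>t\<close> is a subalgebra containing \<open>s\<close>, hence
  contains every polynomial in \<open>s\<close>.\<close>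

lemma subalgebra_commutes:
  assumes "\<And>S. subalgebra S \<Longrightarrow> s \<in> S \<Longrightarrow> V \<in> S" and "s * t = t * s"
  shows "V * t = t * V"
  using assms(1)[OF subalgebra_commutant[of t]] assms(2) by simp

end

lemma power_mult_commuting:
  fixes a b :: "'e::monoid_mult"
  assumes "a * b = b * a"
  shows "(a * b) ^ k = a ^ k * b ^ k"
proof (induction k)
  case (Suc k)
  have "b * a ^ k = a ^ k * b"
    using power_commuting_commutes[of a b k] assms by simp
  then show ?case
    using Suc by (simp add: mult.assoc) (metis mult.assoc)
qed simp

text \<open>Induction on \<open>k\<close>, splitting \<open>e\<close> into two orthogonal
  idempotents on which \<open>s ^ 2 ^ k\<close> is \<open>d\<close> and \<open>- d\<close>, where
  \<open>d * d = c\<close>; the square roots on the two parts add up. At \<open>k = 0\<close> the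
  element \<open>s\<close> is itself a scalar on \<open>e\<close>. The clause on subalgebras says
  that \<open>V\<close> is a polynomial in \<open>s\<close> and \<open>e\<close>, which later makes
  it central.\<close>

lemma sqrt_on_idempotent:
  fixes sc :: "complex \<Rightarrow> 'e::ring_1"
  assumes "central_scalars sc" and "e * e = e" "s * e = e * s" "s ^ 2 ^ k * e = sc c * e" "c \<noteq> 0"
  shows "\<exists>V. V * V = s * e \<and> V * e = V \<and> e * V = V \<and>
    (\<forall>S. central_scalars.subalgebra sc S \<longrightarrow> s \<in> S \<longrightarrow> e \<in> S \<longrightarrow> V \<in> S)"
  using assms(2-)
proof (induction k arbitrary: c e)
  case 0
  interpret central_scalars sc by fact
  let ?V = "sc (csqrt c) * e"
  have "?V * ?V = sc (csqrt c * csqrt c) * (e * e)"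
    by (simp only: mult.assoc sc_left_commute[of e] sc_mult)
  also have "\<dots> = s * e"
    using 0 by (simp flip: power2_eq_square)
  finally show ?case
    using 0 by (intro exI[of _ ?V])
      (auto simp: mult.assoc sc_left_commute[of e] intro!: subalgebra_mult subalgebra_sc)
next
  case (Suc k)
  interpret central_scalars sc by fact
  define d where "d = csqrt c"
  have d: "d * d = c" "d \<noteq> 0"
    using Suc.prems by (simp_all add: d_def flip: power2_eq_square)
  \<comment> \<open>Normalised so that \<open>t\<close> is an involution on \<open>e\<close>; the
    eigenprojections \<open>(1 + t) / 2\<close> and \<open>(1 - t) / 2\<close> of \<open>t\<close>
    then cut \<open>e\<close> into \<open>e1\<close> and \<open>e2\<close>.\<close>
  define t where "t = sc (1 / d) * s ^ 2 ^ k"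
  have scd: "sc d * sc (1 / d) = 1"
    using d by (simp flip: sc_mult)
  have st: "s * t = t * s"
    unfolding t_def sc_left_commute[of s] mult.assoc power_commutes ..
  have "e * s ^ 2 ^ k = s ^ 2 ^ k * e"
    using power_commuting_commutes[of s e] Suc.prems by simp
  then have te: "t * e = e * t"
    unfolding t_def mult.assoc sc_left_commute[of e] by simp
  have "s ^ 2 ^ Suc k = s ^ 2 ^ k * s ^ 2 ^ k"
    by (simp add: mult_2 power_add)
  then have "t * t * e = sc (1 / d * (1 / d)) * (s ^ 2 ^ Suc k * e)"
    unfolding t_def sc_mult by (simp only: mult.assoc sc_left_commute[of "s ^ 2 ^ k"])
  then have tte: "t * t * e = e"
    unfolding Suc.prems(3) using d Suc.prems(4) by (simp add: mult.assoc[symmetric] flip: sc_mult)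
  define e1 where "e1 = sc (1 / 2) * (e + t * e)"
  define e2 where "e2 = sc (1 / 2) * (e - t * e)"
  have half: "sc (1/2) * a + sc (1/2) * a = a" for a
    by (simp flip: sc_add distrib_right)
  have ee: "e * e = e" by fact
  have ete1: "e * (t * e) = t * e"
    by (metis ee te mult.assoc)
  have ete: "e * (t * e) = t * e" "(t * e) * e = t * e" "(t * e) * (t * e) = e"
    using tte by (simp_all add: mult.assoc ee ete1)
  have q: "sc (1/2) * a * (sc (1/2) * b) = sc (1/4) * (a * b)" for a b
  proof -
    have "sc (1/2) * a * (sc (1/2) * b) = sc (1/2 * (1/2)) * (a * b)"
      by (simp only: mult.assoc sc_left_commute[of a] sc_mult)
    then show ?thesis by simp
  qed
  have q2: "sc (1/4) * (a + a) = sc (1/2) * a" for a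
    unfolding distrib_left by (simp flip: sc_add distrib_right)
  have e12: "e1 * e1 = e1" "e2 * e2 = e2" "e1 * e2 = 0" "e2 * e1 = 0" "e1 + e2 = e"
    "e * e1 = e1" "e * e2 = e2" "e1 * e = e1" "e2 * e = e2"
  proof -
    have "(e + t * e) * (e + t * e) = (e + t * e) + (e + t * e)"
      "(e - t * e) * (e - t * e) = (e - t * e) + (e - t * e)"
      "(e + t * e) * (e - t * e) = 0" "(e - t * e) * (e + t * e) = 0"
      by (simp_all add: distrib_left distrib_right left_diff_distrib right_diff_distrib ee ete)
    then show "e1 * e1 = e1" "e2 * e2 = e2" "e1 * e2 = 0" "e2 * e1 = 0"
      unfolding e1_def e2_def q by (simp_all add: q2)
    show "e1 + e2 = e"
      unfolding e1_def e2_def distrib_left right_diff_distrib using half[of e] by simp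
    show "e1 * e = e1" "e2 * e = e2"
      unfolding e1_def e2_def by (simp_all add: mult.assoc distrib_right left_diff_distrib ee ete[unfolded mult.assoc])
    show "e * e1 = e1" "e * e2 = e2"
      unfolding e1_def e2_def sc_left_commute[of e] by (simp_all add: distrib_left right_diff_distrib ee ete)
  qed
  have sd: "s ^ 2 ^ k = sc d * t"
    unfolding t_def mult.assoc[symmetric] scd by simp
  have te12: "t * e1 = e1" "t * e2 = - e2"
  proof -
    show "t * e1 = e1" "t * e2 = - e2"
      using tte unfolding e1_def e2_def sc_left_commute[of t]
      by (simp_all add: distrib_left right_diff_distrib mult.assoc add.commute)
  qed
  have ste: "s * (t * e) = t * e * s"
    using st Suc.prems(2) by (simp add: mult.assoc[symmetric]) (simp add: mult.assoc)
  have se: "s * e1 = e1 * s" "s * e2 = e2 * s"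
    unfolding e1_def e2_def sc_left_commute[of s] mult.assoc[of "sc (1/2)"]
    by (simp_all only: distrib_left[of s] distrib_right right_diff_distrib[of s] left_diff_distrib ste Suc.prems(2))
  have "s ^ 2 ^ k * e1 = sc d * e1" "s ^ 2 ^ k * e2 = sc (- d) * e2"
    unfolding sd mult.assoc te12 by (simp_all add: sc_uminus)
  with Suc.IH[OF e12(1) se(1) _ d(2)] Suc.IH[OF e12(2) se(2), of "- d"] d(2)
  obtain V1 V2 where V1: "V1 * V1 = s * e1" "V1 * e1 = V1" "e1 * V1 = V1"
      "\<And>S. subalgebra S \<Longrightarrow> s \<in> S \<Longrightarrow> e1 \<in> S \<Longrightarrow> V1 \<in> S"
    and V2: "V2 * V2 = s * e2" "V2 * e2 = V2" "e2 * V2 = V2"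
      "\<And>S. subalgebra S \<Longrightarrow> s \<in> S \<Longrightarrow> e2 \<in> S \<Longrightarrow> V2 \<in> S"
    by auto
  \<comment> \<open>Each root absorbs its own idempotent, so the zero product \<open>e1 * e2\<close>
    can be inserted between the two roots.\<close>
  have "V1 * V2 = 0" "V2 * V1 = 0"
    using arg_cong[OF e12(3), of "\<lambda>a. V1 * (a * V2)"] arg_cong[OF e12(4), of "\<lambda>a. V2 * (a * V1)"]
    by (simp_all add: mult.assoc V1(3) V2(3)) (simp_all add: mult.assoc[symmetric] V1(2) V2(2))
  then have "(V1 + V2) * (V1 + V2) = s * e"
    using e12(5) by (simp add: distrib_left distrib_right V1 V2 flip: e12(5))
  moreover have "(V1 + V2) * e = V1 + V2" "e * (V1 + V2) = V1 + V2"
    using arg_cong[OF e12(8), of "(*) V1"] arg_cong[OF e12(9), of "(*) V2"]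
      arg_cong[OF e12(6), of "\<lambda>a. a * V1"] arg_cong[OF e12(7), of "\<lambda>a. a * V2"]
    by (simp_all add: distrib_left distrib_right mult.assoc V1(3) V2(3))
      (simp_all add: mult.assoc[symmetric] V1(2) V2(2))
  moreover have "V1 + V2 \<in> S" if S: "subalgebra S" "s \<in> S" "e \<in> S" for S
  proof -
    have "e1 \<in> S" "e2 \<in> S"
      unfolding e1_def e2_def t_def by (intro subalgebra_intros[OF S(1)] S)+
    then show ?thesis
      using V1(4) V2(4) S by (intro subalgebra_add[OF S(1)]) auto
  qed
  ultimately show ?case by blast
qed

lemma central_sqrt:
  fixes sc :: "complex \<Rightarrow> 'e::ring_1"
  assumes "central_scalars sc" and "s ^ 2 ^ k = 1"
  shows "\<exists>V. V * V = s \<and> (\<forall>S. central_scalars.subalgebra sc S \<longrightarrow> s \<in> S \<longrightarrow> V \<in> S)"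
proof -
  interpret central_scalars sc by fact
  show ?thesis
    using sqrt_on_idempotent[OF assms(1), of 1 s k 1] assms(2) subalgebra_1 by auto
qed


section \<open>The two complex group algebras inside one ring\<close>

fun triple :: "'e \<Rightarrow> 'e \<Rightarrow> 'e \<Rightarrow> gens \<Rightarrow> 'e" where
  "triple x y z Gx = x"
| "triple x y z Gy = y"
| "triple x y z Gz = z"

lemma all_gens: "(\<forall>g. P g) \<longleftrightarrow> P Gx \<and> P Gy \<and> P Gz"
  by (metis gens.exhaust)

context gen_rels
begin

lemma presented_rep_relsG:
  assumes "central_scalars sc" "x ^ 2 ^ n = 1" "y ^ 2 ^ m = 1" "z ^ 2 ^ l = 1"
  shows "presented_rep sc (relsG n m l) (triple x y z) (triple x' y' z')"
  unfolding presented_rep_relsG_iff all_gens using assms gen_rels_axioms by simp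

lemma presented_rep_relsH:
  assumes "central_scalars sc" "x ^ 2 ^ n = 1" "y ^ 2 ^ m = x ^ 2 ^ m" "z ^ 2 ^ l = 1"
  shows "presented_rep sc (relsH n m l) (triple x y z) (triple x' y' z')"
  unfolding presented_rep_relsH_iff all_gens using assms gen_rels_axioms by simp

end

text \<open>Applied to the projections \<open>fst\<close> and \<open>snd\<close>, this reads off one
  component of a representation by pairs.\<close>

lemma (in presented_rep) lin_image:
  assumes "central_scalars sc2" "\<And>r. h (sc r) = sc2 r" "\<And>a b. h (a * b) = h a * h b"
    "\<And>a b. h (a + b) = h a + h b" "h 0 = 0" "h 1 = 1" "p \<in> carrier GA"
  shows "presented_rep.lin sc2 (\<lambda>x. h (f x)) (\<lambda>x. h (f' x)) p = h (lin p)"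
proof -
  have wev: "wev (\<lambda>x. h (f x)) (\<lambda>x. h (f' x)) w = h (wev f f' w)" for w
    by (induction w) (auto simp: assms)
  interpret B: presented_rep sc2 R "\<lambda>x. h (f x)" "\<lambda>x. h (f' x)"
    by (rule presented_rep.intro[OF assms(1)], unfold_locales)
      (auto simp: wev wev_rel simp flip: assms(3) intro: assms)
  have h_sum: "h (sum g S) = (\<Sum>x\<in>S. h (g x))" for g :: "'a word set \<Rightarrow> 'e" and S
    by (induction S rule: infinite_finite_induct) (simp_all add: assms)
  show ?thesis
    by (simp add: lin_def B.lin_def rho_def B.rho_def h_sum assms wev)
qed

text \<open>In the ring of pairs of operators on the two regular modules, the two group algebras become
  the same subalgebra: they share \<open>x\<close> and \<open>z\<close>, and \<open>b = y * V\<close> for a central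
  square root \<open>V\<close> of \<open>x\<^sup>2\<close>, so that \<open>V ^ 2 ^ m = x ^ 2 ^ m\<close>.\<close>

theorem complex_group_algebras_iso:
  assumes "m \<ge> 1" "n \<ge> 1"
  shows "is_algebra_iso (group_algebra TYPE(complex) (grpG n m l)) (group_algebra TYPE(complex) (grpH n m l))"
proof -
  let ?G = "relsG n m l" and ?H = "relsH n m l"
  interpret rG: regular_rep "\<lambda>c. c" ?G
    by unfold_locales auto
  interpret rH: regular_rep "\<lambda>c. c" ?H
    by unfold_locales auto
  have relG: "gen_rels_fun (regf ?G) (regf' ?G)" "regf ?G Gx ^ 2 ^ n = 1" "regf ?G Gy ^ 2 ^ m = 1" "regf ?G Gz ^ 2 ^ l = 1"
    using rG.presented_rep_axioms unfolding presented_rep_relsG_iff by simp_all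
  have relH: "gen_rels_fun (regf ?H) (regf' ?H)" "regf ?H Gx ^ 2 ^ n = 1" "regf ?H Gy ^ 2 ^ m = regf ?H Gx ^ 2 ^ m"
    "regf ?H Gz ^ 2 ^ l = 1"
    using rH.presented_rep_axioms unfolding presented_rep_relsH_iff by simp_all
  let ?sc = "\<lambda>c. (scal c, scal c) :: gens word set lend \<times> gens word set lend"
  define x x' y0 y0' z z' where defs: "x = (regf ?G Gx, regf ?H Gx)" "x' = (regf' ?G Gx, regf' ?H Gx)"
    "y0 = (regf ?G Gy, regf ?H Gy)" "y0' = (regf' ?G Gy, regf' ?H Gy)"
    "z = (regf ?G Gz, regf ?H Gz)" "z' = (regf' ?G Gz, regf' ?H Gz)"
  interpret P: central_scalars ?sc
    by unfold_locales
      (simp_all only: rG.sc_add rG.sc_mult prod_eq_iff fst_mult snd_mult fst_one snd_one fst_conv snd_conv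
        fst_add snd_add rG.sc_1, simp_all only: rG.sc_comm)
  interpret r0: gen_rels x x' y0 y0' z z'
    unfolding defs by (intro gen_rels_prod relG relH)
  have xn: "x ^ 2 ^ n = 1" and zl: "z ^ 2 ^ l = 1"
    by (simp_all add: prod_eq_iff defs relG relH)
  have "(x * x) ^ 2 ^ n = 1"
    by (simp add: power_mult_commuting xn)
  then obtain V where VV: "V * V = x * x" and V: "\<And>S. P.subalgebra S \<Longrightarrow> x * x \<in> S \<Longrightarrow> V \<in> S"
    using central_sqrt[OF P.central_scalars_axioms, of "x * x" n] by auto
  have Vcomm: "V * t = t * V" if "x * x * t = t * (x * x)" for t
    using P.subalgebra_commutes[OF V that] .
  \<comment> \<open>The inverse of \<open>V\<close>, because \<open>V * V = x * x\<close>.\<close>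
  define W where "W = V * (x' * x')"
  have Vx: "V * x = x * V" and Vy: "V * y0 = y0 * V" and Vz: "V * z = z * V" and Vx': "V * x' = x' * V"
    by (intro Vcomm; simp add: mult.assoc r0.square_central[unfolded mult.assoc])+
  have VW: "V * W = 1"
    unfolding W_def mult.assoc[of V, symmetric] VV by (simp add: mult.assoc)
  have "W = x' * x' * V"
    unfolding W_def by (rule Vcomm) (simp add: mult.assoc)
  then have WV: "W * V = 1"
    by (simp add: mult.assoc VV)
  have W: "W * t = t * W" if "V * t = t * V" for t
  proof -
    have "W * t = W * (t * V) * W"
      by (simp add: mult.assoc VW)
    also have "\<dots> = W * V * t * W"
      by (simp add: mult.assoc flip: that)
    finally show ?thesis by (simp add: WV)
  qed
  \<comment> \<open>The pair \<open>y0\<close> satisfies the power relation of G in its first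
    component and that of H in its second. So \<open>y\<close> corrects only the second component by
    the inverse of \<open>V\<close>, and \<open>b\<close> only the first by \<open>V\<close>; in
    both components \<open>b = y * V\<close> results.\<close>
  define Vh Wh where "Vh = (fst V, 1 :: gens word set lend)" and "Wh = (fst W, 1 :: gens word set lend)"
  define Vg Wg where "Vg = (1 :: gens word set lend, snd V)" and "Wg = (1 :: gens word set lend, snd W)"
  define y y' where "y = y0 * Wg" and "y' = Vg * y0'"
  define b b' where "b = y0 * Vh" and "b' = Wh * y0'"
  have comm: "fst V * fst t = fst t * fst V" "snd V * snd t = snd t * snd V"
    "fst W * fst t = fst t * fst W" "snd W * snd t = snd t * snd W" if "V * t = t * V" for t
    using that W[OF that] by (metis fst_mult snd_mult)+
  have inv: "fst V * fst W = 1" "snd V * snd W = 1" "fst W * fst V = 1" "snd W * snd V = 1"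
    using VW WV by (metis fst_mult snd_mult fst_one snd_one)+
  interpret rg: gen_rels x x' y y' z z'
    unfolding y_def y'_def
    by (rule r0.twist) (simp_all add: Wg_def Vg_def prod_eq_iff comm Vx Vy Vz inv)
  interpret rh: gen_rels x x' b b' z z'
    unfolding b_def b'_def
    by (rule r0.twist) (simp_all add: Wh_def Vh_def prod_eq_iff comm Vx Vy Vz inv)
  have "b = y * V" "b' = W * y'" "y = b * W" "y' = V * b'"
    using Vy
    by (simp_all add: b_def b'_def y_def y'_def prod_eq_iff Wh_def Vh_def Wg_def Vg_def mult.assoc inv)
      (simp_all add: mult.assoc[symmetric] inv)
  have Vm: "V ^ 2 ^ m = x ^ 2 ^ m"
  proof -
    have "V ^ 2 ^ m = (V * V) ^ 2 ^ (m - 1)" "x ^ 2 ^ m = (x * x) ^ 2 ^ (m - 1)"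
      using assms(1) by (simp_all flip: power2_eq_square power_mult power_Suc)
    then show ?thesis using VV by simp
  qed
  have VWm: "V ^ 2 ^ m * W ^ 2 ^ m = 1"
    by (simp add: power_mult_commuting[symmetric] VW WV)
  have ym: "y ^ 2 ^ m = 1"
  proof -
    have "snd y ^ 2 ^ m = snd x ^ 2 ^ m * snd W ^ 2 ^ m"
      using power_mult_commuting[of "snd y0" "snd W"] comm(4)[OF Vy] relH(3)
      by (simp add: y_def Wg_def defs)
    also have "\<dots> = snd (V ^ 2 ^ m * W ^ 2 ^ m)"
      by (simp add: Vm)
    finally have "snd (y ^ 2 ^ m) = snd 1"
      by (simp add: VWm)
    moreover have "fst (y ^ 2 ^ m) = fst 1"
      by (simp add: y_def Wg_def defs relG)
    ultimately show ?thesis by (simp add: prod_eq_iff)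
  qed
  have bm: "b ^ 2 ^ m = x ^ 2 ^ m"
  proof -
    have "fst (b ^ 2 ^ m) = fst (x ^ 2 ^ m)"
      using power_mult_commuting[of "fst y0" "fst V"] comm(1)[OF Vy] relG(3) arg_cong[OF Vm, of fst]
      by (simp add: b_def Vh_def defs)
    moreover have "snd (b ^ 2 ^ m) = snd (x ^ 2 ^ m)"
      by (simp add: b_def Vh_def defs relH)
    ultimately show ?thesis by (simp add: prod_eq_iff)
  qed
  note A = rg.presented_rep_relsG[OF P.central_scalars_axioms xn ym zl]
  note B = rh.presented_rep_relsH[OF P.central_scalars_axioms xn bm zl]
  interpret A: presented_rep ?sc ?G "triple x y z" "triple x' y' z'" by (fact A)
  interpret B: presented_rep ?sc ?H "triple x b z" "triple x' b' z'" by (fact B)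
  \<comment> \<open>The uncorrected component of each representation is the regular one, so both
    representations by pairs are faithful.\<close>
  have fstA: "fst (A.lin p) = rG.lin p" if "p \<in> carrier A.GA" for p
  proof -
    have "(\<lambda>g. fst (triple x y z g)) = regf ?G" "(\<lambda>g. fst (triple x' y' z' g)) = regf' ?G"
      by (auto simp: fun_eq_iff all_gens defs y_def y'_def Wg_def Vg_def)
    then show ?thesis
      using A.lin_image[OF rG.central_scalars_axioms _ _ _ _ _ that, of fst] by simp
  qed
  have sndB: "snd (B.lin p) = rH.lin p" if "p \<in> carrier B.GA" for p
  proof -
    have "(\<lambda>g. snd (triple x b z g)) = regf ?H" "(\<lambda>g. snd (triple x' b' z' g)) = regf' ?H"
      by (auto simp: fun_eq_iff all_gens defs b_def b'_def Wh_def Vh_def)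
    then show ?thesis
      using B.lin_image[OF rG.central_scalars_axioms _ _ _ _ _ that, of snd] by simp
  qed
  have injA: "inj_on A.lin (carrier A.GA)"
    by (rule inj_onI, rule inj_onD[OF rG.inj_lin]) (simp_all flip: fstA)
  have injB: "inj_on B.lin (carrier B.GA)"
    by (rule inj_onI, rule inj_onD[OF rH.inj_lin]) (simp_all flip: sndB)
  \<comment> \<open>Both images contain \<open>x\<close> and its inverse, hence \<open>V\<close> and
    \<open>W\<close>, and therefore each other's second generator.\<close>
  have W_mem: "W \<in> S" "V \<in> S" if "P.subalgebra S" "x \<in> S" "x' \<in> S" for S
    unfolding W_def by (intro P.subalgebra_mult[OF that(1)] V that)+
  note S = A.subalgebra_range_lin B.subalgebra_range_lin
  note memA = A.f_in_range_lin[of Gx, simplified] A.f_in_range_lin[of Gy, simplified] A.f_in_range_lin[of Gz, simplified]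
  note memB = B.f_in_range_lin[of Gx, simplified] B.f_in_range_lin[of Gy, simplified] B.f_in_range_lin[of Gz, simplified]
  have "y \<in> B.lin ` carrier B.GA" "y' \<in> B.lin ` carrier B.GA"
    unfolding \<open>y = b * W\<close> \<open>y' = V * b'\<close>
    by (intro P.subalgebra_mult[OF S(2)] W_mem[OF S(2)] memB)+
  then have gA: "triple x y z g \<in> B.lin ` carrier B.GA" "triple x' y' z' g \<in> B.lin ` carrier B.GA" for g
    using memB by (cases g; simp)+
  have "b \<in> A.lin ` carrier A.GA" "b' \<in> A.lin ` carrier A.GA"
    unfolding \<open>b = y * V\<close> \<open>b' = W * y'\<close>
    by (intro P.subalgebra_mult[OF S(1)] W_mem[OF S(1)] memA)+
  then have gB: "triple x b z g \<in> A.lin ` carrier A.GA" "triple x' b' z' g \<in> A.lin ` carrier A.GA" for g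
    using memA by (cases g; simp)+
  show ?thesis
    unfolding grpG_eq grpH_eq
    by (rule algebra_iso_of_common_range[OF A B injA injB gA gB])
qed

section \<open>Fields of roots of unity\<close>

text \<open>The properties used of the field generated by the \<open>2 ^ k\<close>-th roots of
  unity. The last condition excludes primitive \<open>2 ^ (k + 1)\<close>-th roots of unity, which
  are exactly the solutions of \<open>a ^ 2 ^ k = - 1\<close>.\<close>

definition root_field :: "nat \<Rightarrow> complex set \<Rightarrow> bool" where
  "root_field k K \<longleftrightarrow> range of_rat \<subseteq> K \<and> (\<forall>a\<in>K. \<forall>b\<in>K. a + b \<in> K \<and> a * b \<in> K) \<and> (\<forall>a\<in>K. inverse a \<in> K) \<and>
     (\<forall>a. a ^ 2 ^ k = 1 \<longrightarrow> a \<in> K) \<and> (\<forall>a\<in>K. a ^ 2 ^ k \<noteq> - 1)"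

lemma rat_square_neq_2: "r * r \<noteq> (2 :: rat)"
proof
  assume r: "r * r = 2"
  obtain a b :: int where ab: "r = Fract a b" "b > 0" "coprime a b"
    by (cases r)
  then have "of_int a = r * of_int b"
    by (simp add: Fract_of_int_quotient)
  then have "of_int a * of_int a = (r * r) * (of_int b * of_int b)"
    by (simp add: mult_ac)
  then have "of_int (a * a) = (of_int (2 * (b * b)) :: rat)"
    using r by simp
  then have "a * a = 2 * (b * b)"
    by (simp only: of_int_eq_iff)
  then have "even a"
    by (metis dvd_triv_left even_mult_iff)
  then obtain c where "a = 2 * c" ..
  with \<open>a * a = 2 * (b * b)\<close> have "b * b = 2 * (c * c)" by simp
  then have "even b"
    by (metis dvd_triv_left even_mult_iff)
  with \<open>even a\<close> ab(3) show False by auto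
qed

lemma of_rat_complex: "of_rat r = complex_of_real (of_rat r)"
  by (cases r) (simp add: of_rat_rat)

text \<open>A square root of \<open>\<i>\<close> or \<open>- \<i>\<close> with rational parts
  \<open>p\<close> and \<open>q\<close> has \<open>p = q\<close> or \<open>p = - q\<close> and
  \<open>2 * p * q = 1\<close> or \<open>- 1\<close>, which makes 2 the square of the rational
  \<open>2 * p\<close>. The tower starts here because its inductive step relies on
  \<open>k \<ge> 2\<close>.\<close>

lemma root_field_2: "root_field 2 {of_rat p + of_rat q * \<i> | p q. True}" (is "root_field 2 ?K")
  unfolding root_field_def
proof (intro conjI ballI allI impI)
  have I: "a = of_rat p + of_rat q * \<i> \<Longrightarrow> a \<in> ?K" for a p q by blast
  show "range of_rat \<subseteq> ?K"
    using I[of _ _ 0] by auto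
  show "a + b \<in> ?K" if "a \<in> ?K" "b \<in> ?K" for a b
  proof -
    from that obtain p q r s where "a = of_rat p + of_rat q * \<i>" "b = of_rat r + of_rat s * \<i>" by auto
    then show ?thesis by (intro I[of _ "p + r" "q + s"]) (simp add: of_rat_add algebra_simps)
  qed
  show "a * b \<in> ?K" if "a \<in> ?K" "b \<in> ?K" for a b
  proof -
    from that obtain p q r s where "a = of_rat p + of_rat q * \<i>" "b = of_rat r + of_rat s * \<i>" by auto
    then show ?thesis
      by (intro I[of _ "p * r - q * s" "p * s + q * r"])
        (simp add: of_rat_add of_rat_mult of_rat_diff algebra_simps)
  qed
  show "inverse a \<in> ?K" if "a \<in> ?K" for a
  proof -
    from that obtain p q where a: "a = of_rat p + of_rat q * \<i>" by auto
    have "inverse a = of_rat (p / (p * p + q * q)) + of_rat (- q / (p * p + q * q)) * \<i>"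
      unfolding a of_rat_complex
      by (simp add: complex_eq_iff power2_eq_square of_rat_divide of_rat_minus of_rat_add of_rat_mult)
    then show ?thesis by (rule I)
  qed
  have sq: "a * a = 1 \<or> a * a = - 1" if "a ^ 4 = 1" for a :: complex
  proof -
    have "(a * a - 1) * (a * a + 1) = 0"
      using that by (simp add: algebra_simps numeral_eq_Suc)
    then show ?thesis by (auto simp: eq_neg_iff_add_eq_0)
  qed
  show "a \<in> ?K" if "a ^ 2 ^ 2 = 1" for a
  proof -
    have "a * a = 1 \<or> a * a = \<i> * \<i>"
      using sq[of a] that by simp
    then have "a = 1 \<or> a = - 1 \<or> a = \<i> \<or> a = - \<i>"
      using square_eq_iff[of a 1] square_eq_iff[of a \<i>] by auto
    then show ?thesis
      using I[of a 1 0] I[of a "-1" 0] I[of a 0 1] I[of a 0 "-1"] by (auto simp: of_rat_minus)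
  qed
  show "a ^ 2 ^ 2 \<noteq> - 1" if "a \<in> ?K" for a
  proof
    assume "a ^ 2 ^ 2 = - 1"
    then have "(a * a - \<i>) * (a * a + \<i>) = 0"
      by (simp add: algebra_simps numeral_eq_Suc)
    then have i: "a * a = \<i> \<or> a * a = - \<i>"
      by (auto simp: eq_neg_iff_add_eq_0)
    from that obtain p q where a: "a = of_rat p + of_rat q * \<i>" by auto
    have re: "Re (of_rat r) = of_rat r" "Im (of_rat r) = 0" for r
      by (simp_all add: of_rat_complex)
    have "Re (a * a) = 0" "Im (a * a) = 1 \<or> Im (a * a) = - 1"
      using arg_cong[of "a * a" _ Re] arg_cong[of "a * a" _ Im] i by fastforce+
    then have 1: "of_rat (p * p) = (of_rat (q * q) :: real)"
      and 2: "of_rat (2 * p * q) = (of_rat 1 :: real) \<or> of_rat (2 * p * q) = (of_rat (- 1) :: real)"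
      by (simp_all add: a re of_rat_mult of_rat_minus algebra_simps)
    from 1 have "p = q \<or> p = - q"
      by (simp only: of_rat_eq_iff square_eq_iff)
    with 2 have "2 * p * p = 1 \<or> 2 * p * p = - 1"
      by (auto simp only: of_rat_eq_iff)
    moreover have "2 * p * p \<ge> 0"
      by simp
    ultimately have "(2 * p) * (2 * p) = 2"
      by auto
    then show False
      using rat_square_neq_2 by blast
  qed
qed

text \<open>Adjoin a root \<open>\<theta>\<close> of \<open>\<theta> ^ 2 ^ k = - 1\<close>,
  quadratic over \<open>K\<close> since its square is a \<open>2 ^ k\<close>-th root of unity. A
  \<open>2 ^ (k + 1)\<close>-th root of unity outside \<open>K\<close> is \<open>\<theta>\<close>
  times one in \<open>K\<close>. Should a square root of such an element lie in \<open>K'\<close>,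
  comparing coefficients would put a forbidden root of -1 into \<open>K\<close>.\<close>

lemma root_field_Suc:
  assumes K: "root_field k K" and k: "k \<ge> 2"
  shows "\<exists>K'. root_field (Suc k) K'"
proof -
  have K_rat: "of_rat r \<in> K" and K_add: "a \<in> K \<Longrightarrow> b \<in> K \<Longrightarrow> a + b \<in> K"
    and K_mult: "a \<in> K \<Longrightarrow> b \<in> K \<Longrightarrow> a * b \<in> K" and K_inv: "a \<in> K \<Longrightarrow> inverse a \<in> K"
    and K_root: "a ^ 2 ^ k = 1 \<Longrightarrow> a \<in> K" and K_no: "a \<in> K \<Longrightarrow> a ^ 2 ^ k \<noteq> - 1" for a b r
    using K by (auto simp: root_field_def)
  have K_01: "0 \<in> K" "1 \<in> K" "-1 \<in> K" "2 \<in> K"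
    using K_rat[of 0] K_rat[of 1] K_rat[of "-1"] K_rat[of 2] by (simp_all add: of_rat_minus)
  have K_uminus: "a \<in> K \<Longrightarrow> - a \<in> K" for a
    using K_mult[OF K_01(3), of a] by simp
  have K_diff: "a \<in> K \<Longrightarrow> b \<in> K \<Longrightarrow> a - b \<in> K" for a b
    using K_add[OF _ K_uminus, of a b] by simp
  have K_div: "a \<in> K \<Longrightarrow> b \<in> K \<Longrightarrow> a / b \<in> K" for a b
    using K_mult[OF _ K_inv, of a b] by (simp add: divide_inverse)
  note K_closed = K_add K_mult K_uminus K_diff K_div K_01
  define \<theta> where "\<theta> = cis (pi / 2 ^ k)"
  have \<theta>: "\<theta> ^ 2 ^ k = - 1"
    by (simp add: \<theta>_def DeMoivre)
  have \<theta>0: "\<theta> \<noteq> 0" by (simp add: \<theta>_def)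
  from \<theta> have \<theta>K: "\<theta> \<notin> K"
    using K_no by blast
  define \<omega> where "\<omega> = \<theta> * \<theta>"
  have "\<omega> ^ 2 ^ k = 1"
    by (simp add: \<omega>_def power_mult_distrib \<theta>)
  then have \<omega>: "\<omega> \<in> K"
    by (rule K_root)
  have zero: "p = 0 \<and> q = 0" if "p \<in> K" "q \<in> K" "p + q * \<theta> = 0" for p q
  proof -
    have "q = 0"
    proof (rule ccontr)
      assume "q \<noteq> 0"
      with that(3) have "\<theta> = - (p / q)"
        by (simp add: field_simps eq_neg_iff_add_eq_0)
      then show False using \<theta>K K_closed that by metis
    qed
    then show ?thesis using that by simp
  qed
  define K' where "K' = {p + q * \<theta> | p q. p \<in> K \<and> q \<in> K}"
  have K'I: "p + q * \<theta> \<in> K'" if "p \<in> K" "q \<in> K" for p q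
    using that by (auto simp: K'_def)
  have KK': "p \<in> K'" if "p \<in> K" for p
    using K'I[OF that K_01(1)] by simp
  have "root_field (Suc k) K'"
    unfolding root_field_def
  proof (intro conjI ballI allI impI)
    show "range of_rat \<subseteq> K'"
      using K_rat KK' by auto
  next
    fix a b assume "a \<in> K'" "b \<in> K'"
    then obtain p q r s where a: "a = p + q * \<theta>" "p \<in> K" "q \<in> K" and b: "b = r + s * \<theta>" "r \<in> K" "s \<in> K"
      by (auto simp: K'_def)
    have "a + b = (p + r) + (q + s) * \<theta>"
      by (simp add: a b algebra_simps)
    then show "a + b \<in> K'"
      using a b by (simp only:) (intro K'I K_closed)
    have "a * b = (p * r + q * s * \<omega>) + (p * s + q * r) * \<theta>"
      by (simp add: a b \<omega>_def algebra_simps)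
    then show "a * b \<in> K'"
      using a b by (simp only:) (intro K'I K_closed \<omega>)
  next
    fix a assume "a \<in> K'"
    then obtain p q where a: "a = p + q * \<theta>" "p \<in> K" "q \<in> K"
      by (auto simp: K'_def)
    show "inverse a \<in> K'"
    proof (cases "a = 0")
      case True
      then show ?thesis using KK'[OF K_01(1)] by simp
    next
      case False
      then have "p + (- q) * \<theta> \<noteq> 0"
        using zero[of p "- q"] a K_uminus by auto
      moreover have prod: "a * (p - q * \<theta>) = p * p - q * q * \<omega>"
        by (simp add: a \<omega>_def algebra_simps)
      ultimately have nz: "p * p - q * q * \<omega> \<noteq> 0"
        unfolding prod[symmetric] using False by simp
      have "inverse a = p / (p * p - q * q * \<omega>) + (- q / (p * p - q * q * \<omega>)) * \<theta>"
      proof -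
        have "inverse a = (p - q * \<theta>) / (p * p - q * q * \<omega>)"
          unfolding prod[symmetric] using nz[folded prod] by (simp add: inverse_eq_divide)
        then show ?thesis by (simp add: diff_divide_distrib)
      qed
      then show ?thesis
        using a by (simp only:) (intro K'I K_closed \<omega>)
    qed
  next
    fix a :: complex assume "a ^ 2 ^ Suc k = 1"
    then have "(a ^ 2 ^ k) ^ 2 = 1"
      by (simp add: power_mult[symmetric] mult.commute)
    then consider "a ^ 2 ^ k = 1" | "a ^ 2 ^ k = - 1"
      by (auto simp: power2_eq_1_iff)
    then show "a \<in> K'"
    proof cases
      case 1
      then show ?thesis using K_root KK' by blast
    next
      case 2
      then have "(a / \<theta>) ^ 2 ^ k = 1"
        by (simp add: power_divide \<theta>)
      then have "0 + a / \<theta> * \<theta> \<in> K'"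
        by (intro K'I K_root K_01)
      then show ?thesis using \<theta>0 by simp
    qed
  next
    fix s assume "s \<in> K'"
    then obtain p q where s: "s = p + q * \<theta>" "p \<in> K" "q \<in> K"
      by (auto simp: K'_def)
    show "s ^ 2 ^ Suc k \<noteq> - 1"
    proof
      assume "s ^ 2 ^ Suc k = - 1"
      then have "(s * s) ^ 2 ^ k = - 1"
        by (simp add: power_mult_distrib mult_2 power_add)
      then have "(s * s / \<theta>) ^ 2 ^ k = 1"
        by (simp add: power_divide \<theta>)
      then have \<kappa>: "s * s / \<theta> \<in> K"
        by (rule K_root)
      \<comment> \<open>As \<open>s * s\<close> is a \<open>K\<close>-multiple of
        \<open>\<theta>\<close>, its component in \<open>K\<close> must vanish.\<close>
      have "(p * p + q * q * \<omega>) + (2 * p * q - s * s / \<theta>) * \<theta> = 0"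
        using \<theta>0 by (simp add: s \<omega>_def field_simps)
      then have eq: "p * p + q * q * \<omega> = 0"
        using zero[of "p * p + q * q * \<omega>" "2 * p * q - s * s / \<theta>"] s \<kappa> \<omega> K_closed by auto
      have "q \<noteq> 0"
        using eq s \<open>s ^ 2 ^ Suc k = - 1\<close> by (auto simp: power_0_left)
      then have "(p / q) * (p / q) = - \<omega>"
        using eq by (simp add: field_simps eq_neg_iff_add_eq_0)
      then have sq: "(p / q) ^ 2 = - \<omega>"
        by (simp add: power2_eq_square)
      \<comment> \<open>Here \<open>k \<ge> 2\<close> enters: the exponent
        \<open>2 ^ (k - 1)\<close> is even and removes the sign of
        \<open>- \<omega>\<close>.\<close>
      have k2: "(2::nat) ^ k = 2 * 2 ^ (k - 1)" and even: "even ((2::nat) ^ (k - 1))"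
        using k by (simp_all flip: power_Suc)
      have "(p / q) ^ 2 ^ k = (- \<omega>) ^ 2 ^ (k - 1)"
        by (simp only: k2 power_mult sq)
      also have "\<dots> = \<omega> ^ 2 ^ (k - 1)"
        using even by simp
      also have "\<dots> = \<theta> ^ 2 ^ k"
        by (simp only: k2 power_mult \<omega>_def power2_eq_square)
      finally show False
        using K_no[OF K_div[OF s(2,3)]] \<theta> by simp
    qed
  qed
  then show ?thesis by blast
qed

lemma root_field_exists: "k \<ge> 2 \<Longrightarrow> \<exists>K. root_field k K"
  by (induction k rule: dec_induct) (use root_field_2 root_field_Suc in blast)+

section \<open>A component of the rational group algebra of G\<close>

lemma commute_mult:
  fixes a b s :: "'a::semigroup_mult"
  assumes "a * s = s * a" "b * s = s * b"
  shows "(a * b) * s = s * (a * b)"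
  by (metis assms mult.assoc)

locale rat_scalars = central_scalars sc for sc :: "rat \<Rightarrow> 'e::ring_1"
begin

text \<open>For \<open>t ^ 2 ^ k = 1\<close> this is the projection to the part on which
  \<open>t\<close> acts as 1; applied to \<open>- t\<close> it projects to the part on which
  \<open>t\<close> acts as -1.\<close>

definition avg :: "nat \<Rightarrow> 'e \<Rightarrow> 'e" where
  "avg k t = sc (1 / 2 ^ k) * (\<Sum>i<2 ^ k. t ^ i)"

lemma avg_fixed:
  assumes "s * a = a"
  shows "avg k s * a = a"
proof -
  have "s ^ i * a = a" for i
    by (induction i) (simp_all add: assms mult.assoc)
  then have "avg k s * a = sc (1 / 2 ^ k) * (of_nat (2 ^ k) * a)"
    by (simp add: avg_def sum_distrib_right mult.assoc)
  also have "\<dots> = sc (1 / 2 ^ k * of_nat (2 ^ k)) * a"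
    unfolding sc_mult sc_of_nat mult.assoc ..
  finally show ?thesis by simp
qed

lemma avg_1 [simp]: "avg k 1 = 1"
  using avg_fixed[of 1 1 k] by simp

lemma mult_avg:
  assumes "t ^ 2 ^ k = 1"
  shows "t * avg k t = avg k t"
proof -
  have "t * (\<Sum>i<N. t ^ i) = (\<Sum>i<N. t ^ i) + t ^ N - 1" for N
    by (induction N) (simp_all add: distrib_left)
  then show ?thesis
    by (simp add: avg_def assms sc_left_commute)
qed

lemma avg_idem: "t ^ 2 ^ k = 1 \<Longrightarrow> avg k t * avg k t = avg k t"
  by (rule avg_fixed[OF mult_avg])

lemma avg_mem: "subalgebra S \<Longrightarrow> t \<in> S \<Longrightarrow> avg k t \<in> S"
  unfolding avg_def by (intro subalgebra_intros)

lemma avg_comm: "t * s = s * t \<Longrightarrow> avg k t * s = s * avg k t"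
  using avg_mem[OF subalgebra_commutant[of s]] by simp

text \<open>An element and its inverse fix the same vectors: each average absorbs the other, and the
  two commute.\<close>

lemma avg_inverse:
  assumes "t * t' = 1" "t' * t = 1" "t ^ 2 ^ k = 1"
  shows "avg k t' = avg k t"
proof -
  have "t' ^ 2 ^ k = 1"
    using power_mult_commuting[of t t' "2 ^ k"] assms by simp
  have "t' * avg k t = avg k t"
    using arg_cong[OF mult_avg[OF assms(3)], of "(*) t'"] assms(2) by (simp flip: mult.assoc)
  moreover have "t * avg k t' = avg k t'"
    using arg_cong[OF mult_avg[OF \<open>t' ^ 2 ^ k = 1\<close>], of "(*) t"] assms(1) by (simp flip: mult.assoc)
  moreover have "avg k t * avg k t' = avg k t' * avg k t"
    by (intro avg_comm avg_comm[symmetric]) (simp add: assms)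
  ultimately show ?thesis
    using avg_fixed[of t' "avg k t" k] avg_fixed[of t "avg k t'" k] by simp
qed

lemma avg_intertwine:
  assumes "t * s = s * t'"
  shows "avg k t * s = s * avg k t'"
proof -
  have "t ^ i * s = s * t' ^ i" for i
  proof (induction i)
    case (Suc i)
    then show ?case by (simp add: mult.assoc) (simp add: assms flip: mult.assoc)
  qed simp
  then show ?thesis
    by (simp add: avg_def sum_distrib_left sum_distrib_right mult.assoc sc_left_commute[of s])
qed

end

locale rational_rels = rat_scalars sc + gen_rels x x' y y' z z'
  for sc :: "rat \<Rightarrow> 'e::ring_1" and x x' y y' z z' :: 'e +
  fixes n m l :: nat
  assumes xn: "x ^ 2 ^ n = 1" and ym: "y ^ 2 ^ m = 1" and zl: "z ^ 2 ^ l = 1"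
    and n: "n \<ge> 4" and l: "l \<ge> 1"
begin

abbreviation "X \<equiv> x * x"

text \<open>The summand on which \<open>z * z = - 1\<close>, \<open>y * y = 1\<close> and
  \<open>X ^ 2 ^ (n - 2) = - 1\<close>. The first condition keeps \<open>x\<close> and
  \<open>z\<close> from commuting, the last makes \<open>X\<close> act as a primitive
  \<open>2 ^ (n - 1)\<close>-th root of unity.\<close>

definition e where
  "e = avg l (- (z * z)) * (avg m (y * y) * avg n (- (X ^ 2 ^ (n - 2))))"

lemma X_comm: "X ^ k * x = x * X ^ k" "X ^ k * y = y * X ^ k" "X ^ k * z = z * X ^ k"
  by (rule power_commuting_commutes, simp add: mult.assoc)
    (rule power_commuting_commutes, rule square_central)+

text \<open>Conjugation by \<open>x\<close> or \<open>y\<close> replaces \<open>z\<close> by its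
  inverse, which leaves the average unchanged.\<close>

lemma avg_zz_comm:
  "avg l (- (z * z)) * x = x * avg l (- (z * z))"
  "avg l (- (z * z)) * y = y * avg l (- (z * z))"
  "avg l (- (z * z)) * z = z * avg l (- (z * z))"
proof -
  have "(- (z * z)) ^ 2 ^ l = 1"
    using l by (simp add: power_mult_commuting zl)
  then have inv: "avg l (- (z' * z')) = avg l (- (z * z))"
    by (intro avg_inverse) (simp_all add: mult.assoc)
  have "avg l (- (z * z)) * x = x * avg l (- (z' * z'))" "avg l (- (z * z)) * y = y * avg l (- (z' * z'))"
    by (rule avg_intertwine, simp add: normal_form mult.assoc)+
  then show "avg l (- (z * z)) * x = x * avg l (- (z * z))"
    "avg l (- (z * z)) * y = y * avg l (- (z * z))"
    unfolding inv .
  show "avg l (- (z * z)) * z = z * avg l (- (z * z))"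
    by (rule avg_comm) (simp add: mult.assoc)
qed

lemma avg_yy_comm: "(y * y) * s = s * (y * y) \<Longrightarrow> avg m (y * y) * s = s * avg m (y * y)"
  by (rule avg_comm)

lemma avg_X_comm: "X ^ 2 ^ (n - 2) * s = s * X ^ 2 ^ (n - 2) \<Longrightarrow>
    avg n (- (X ^ 2 ^ (n - 2))) * s = s * avg n (- (X ^ 2 ^ (n - 2)))"
  by (rule avg_comm) simp

lemma e_comm: "e * x = x * e" "e * y = y * e" "e * z = z * e"
proof -
  show "e * x = x * e" "e * y = y * e" "e * z = z * e"
    unfolding e_def
    by (intro commute_mult avg_zz_comm avg_yy_comm avg_X_comm X_comm square_central; simp add: mult.assoc)+
qed

lemma zz_pow: "(- (z * z)) ^ 2 ^ l = 1"
  using l by (simp add: power_mult_commuting zl)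

lemma yy_pow: "(y * y) ^ 2 ^ m = 1"
  by (simp add: power_mult_commuting ym)

lemma X_pow: "(- (X ^ 2 ^ (n - 2))) ^ 2 ^ n = 1"
proof -
  have "X ^ 2 ^ n = 1"
    by (simp add: power_mult_commuting xn)
  then have "(X ^ 2 ^ (n - 2)) ^ 2 ^ n = 1"
    by (simp add: power_mult[symmetric] mult.commute[of "2 ^ (n - 2)"]) (simp add: power_mult)
  then show ?thesis
    using n by simp
qed

lemma e_facts: "e * e = e" "z * z * e = - e" "y * y * e = e" "X ^ 2 ^ (n - 2) * e = - e"
proof -
  let ?A = "avg l (- (z * z))" and ?B = "avg m (y * y)" and ?C = "avg n (- (X ^ 2 ^ (n - 2)))"
  have yyA: "y * y * ?A = ?A * (y * y)"
    by (intro commute_mult avg_zz_comm(2)[symmetric])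
  have XA: "X ^ k * ?A = ?A * X ^ k" for k
    by (intro power_commuting_commutes commute_mult avg_zz_comm(1)[symmetric])
  have yyX: "y * y * X ^ k = X ^ k * (y * y)" for k
    by (intro commute_mult X_comm(2)[symmetric])
  have XB: "X ^ k * ?B = ?B * X ^ k" for k
    using avg_yy_comm[OF yyX] by simp
  have BA: "?B * ?A = ?A * ?B"
    by (rule avg_yy_comm[OF yyA])
  have CA: "?C * ?A = ?A * ?C" and CB: "?C * ?B = ?B * ?C"
    by (intro avg_X_comm XA XB)+
  have idem: "(a * b) * (a * b) = a * b" if "a * a = a" "b * b = b" "b * a = a * b" for a b :: 'e
  proof -
    have "(a * b) * (a * b) = a * (b * a) * b"
      by (simp add: mult.assoc)
    also have "\<dots> = (a * a) * (b * b)"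
      unfolding that(3) by (simp only: mult.assoc)
    finally show ?thesis using that by simp
  qed
  have "(?B * ?C) * ?A = ?A * (?B * ?C)"
    by (intro commute_mult BA CA)
  then show "e * e = e"
    unfolding e_def by (intro idem avg_idem zz_pow yy_pow X_pow CB)
  have "- (z * z) * e = e"
    unfolding e_def using mult_avg[OF zz_pow] by (simp only: mult.assoc[symmetric])
  then show "z * z * e = - e"
    by (simp add: minus_equation_iff[of _ e] equation_minus_iff)
  have "y * y * e = ?A * ((y * y * ?B) * ?C)"
    unfolding e_def mult.assoc[symmetric] using yyA by (simp only: mult.assoc[symmetric])
  then show "y * y * e = e"
    unfolding mult_avg[OF yy_pow] e_def[symmetric] .
  have "- (X ^ 2 ^ (n - 2)) * e = ?A * (?B * (- (X ^ 2 ^ (n - 2)) * ?C))"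
    unfolding e_def mult_minus_left mult_minus_right
    by (simp only: mult.assoc[symmetric] XA) (simp only: mult.assoc XB[symmetric])
  then show "X ^ 2 ^ (n - 2) * e = - e"
    unfolding mult_avg[OF X_pow] e_def[symmetric] by (simp add: equation_minus_iff)
qed

lemma z'e: "z' * e = - (z * e)"
  using arg_cong[OF e_facts(2), of "(*) z'"] by (simp add: mult.assoc equation_minus_iff)

definition \<epsilon> where "\<epsilon> = X ^ 2 ^ (n - 4)"
text \<open>On the component of \<open>e\<close>, \<open>\<epsilon>\<close> is a primitive eighth root of unity; the factor \<open>c\<close> is chosen
  to turn \<open>v * v * e = 2 * X * e\<close> into \<open>u * u = X * e\<close>.\<close>

definition c where "c = sc (1 / 2) * (\<epsilon> * (1 - \<epsilon> * \<epsilon>))"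
text \<open>The sum of \<open>y x\<close> and its conjugate \<open>x' (y x) x = y x z'\<close>. As
  \<open>y x\<close> commutes with \<open>z\<close>, this sum is central.\<close>

definition v where "v = y * (x * (1 + z'))"
definition u where "u = v * (c * e)"

lemma c_comm:
  assumes "X * s = s * X"
  shows "c * s = s * c"
proof -
  have S: "subalgebra {a. a * s = s * a}"
    by (rule subalgebra_commutant)
  have "\<epsilon> \<in> {a. a * s = s * a}"
    unfolding \<epsilon>_def by (rule subalgebra_power[OF S]) (use assms in simp)
  then have "c \<in> {a. a * s = s * a}"
    unfolding c_def by (intro subalgebra_intros[OF S])
  then show ?thesis by simp
qed

text \<open>On \<open>e\<close> the element \<open>i = \<epsilon> * \<epsilon>\<close> satisfies
  \<open>i * i = - 1\<close>, hence \<open>i * (1 - i) * (1 - i) = 2\<close>, and \<open>c\<close>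
  carries the factor \<open>1 / 2\<close> twice.\<close>

lemma c_square: "c * (c * e) = sc (1 / 2) * e"
proof -
  let ?i = "\<epsilon> * \<epsilon>"
  have "2 ^ (n - 2) = 2 ^ (n - 4) * (4 :: nat)"
    using n by (auto simp: le_iff_add)
  then have "?i * ?i = X ^ 2 ^ (n - 2)"
    by (simp add: \<epsilon>_def power_mult power4_eq_xxxx mult.assoc)
  then have "(?i * ?i) * e = - e"
    using e_facts(4) by simp
  then have ii: "?i * (?i * e) = - e"
    by (simp only: mult.assoc)
  have "?i * ((1 - ?i) * ((1 - ?i) * e)) = sc 2 * e"
    using ii by (simp add: algebra_simps) (simp add: algebra_simps mult_2 flip: mult.assoc)
  moreover have "(\<epsilon> * (1 - ?i)) * ((\<epsilon> * (1 - ?i)) * e) = ?i * ((1 - ?i) * ((1 - ?i) * e))"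
    by (simp add: algebra_simps)
  moreover have "c * (c * e) = sc (1 / 2 * (1 / 2)) * ((\<epsilon> * (1 - ?i)) * ((\<epsilon> * (1 - ?i)) * e))"
    unfolding c_def sc_mult by (simp only: mult.assoc sc_left_commute[of "1 - \<epsilon> * \<epsilon>"] sc_left_commute[of "\<epsilon>"])
  ultimately have "c * (c * e) = sc (1 / 2 * (1 / 2) * 2) * e"
    unfolding sc_mult mult.assoc by simp
  then show ?thesis by simp
qed

text \<open>Since \<open>(y x) (y x)\<close> is \<open>y y x x z\<close>, squaring gives the factor
  \<open>z (1 + z') (1 + z') = z + 2 + z'\<close>. On \<open>e\<close>, \<open>z\<close> and
  \<open>z'\<close> cancel and \<open>y * y\<close> is 1.\<close>

lemma v_square: "v * (v * e) = sc 2 * (X * e)"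
proof -
  have "v * v = y * (y * (x * (x * (z + 2 + z'))))"
    by (simp add: v_def algebra_simps normal_form mult_2_right)
  then have "v * (v * e) = y * (y * (x * (x * (z * e + z' * e + 2 * e))))"
    by (simp add: algebra_simps flip: mult.assoc)
  also have "\<dots> = (y * y) * (X * e + X * e)"
    by (simp add: z'e mult.assoc mult_2 distrib_left)
  also have "\<dots> = X * (y * y * e) + X * (y * y * e)"
    by (simp add: distrib_left mult.assoc normal_form)
  finally show ?thesis
    by (simp add: e_facts mult_2)
qed

lemma v_comm: "v * x = x * v" "v * y = y * v" "v * z = z * v"
  by (simp_all add: v_def algebra_simps normal_form)

lemma X_central: "X * x = x * X" "X * y = y * X" "X * z = z * X"
  using X_comm[of 1] by simp_all

lemma u_comm: "u * x = x * u" "u * y = y * u" "u * z = z * u"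
  unfolding u_def by (intro commute_mult v_comm e_comm c_comm X_central)+

lemma u_square: "u * u = X * e"
proof -
  have "e * z' = z' * e"
    using e_comm(3) by (metis inv(5) inv_assoc(6) mult.assoc mult_1_right)
  then have "(y * (x * (1 + z'))) * e = e * (y * (x * (1 + z')))"
    by (intro commute_mult e_comm[symmetric]) (simp add: distrib_left distrib_right)
  then have ev: "e * v = v * e"
    unfolding v_def by simp
  have cv: "c * v = v * c"
    by (intro c_comm commute_mult v_comm[symmetric])
  have ce: "c * e = e * c"
    by (intro c_comm commute_mult e_comm[symmetric])
  have cev: "(c * e) * v = v * (c * e)"
    by (intro commute_mult ev cv)
  have "(c * e) * (c * e) = c * ((e * c) * e)"
    by (simp only: mult.assoc)
  also have "\<dots> = c * (c * (e * e))"
    unfolding ce[symmetric] by (simp only: mult.assoc)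
  finally have cece: "(c * e) * (c * e) = sc (1 / 2) * e"
    by (simp add: e_facts c_square)
  have "u * u = v * (((c * e) * v) * (c * e))"
    unfolding u_def by (simp only: mult.assoc)
  also have "\<dots> = v * (v * ((c * e) * (c * e)))"
    unfolding cev by (simp only: mult.assoc)
  also have "\<dots> = sc (1 / 2) * (v * (v * e))"
    unfolding cece by (simp only: sc_left_commute[of v])
  also have "\<dots> = sc (1 / 2 * 2) * (X * e)"
    unfolding v_square sc_mult by (simp only: mult.assoc)
  finally show ?thesis by simp
qed

lemma u_power: "u ^ 2 ^ (n - 1) = - e"
proof -
  have "(2::nat) ^ (n - 1) = 2 * 2 ^ (n - 2)"
    using n by (simp flip: power_Suc add: Suc_diff_le numeral_eq_Suc)
  then have "u ^ 2 ^ (n - 1) = (X * e) ^ 2 ^ (n - 2)"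
    by (simp only: power_mult power2_eq_square u_square)
  also have "\<dots> = X ^ 2 ^ (n - 2) * e ^ 2 ^ (n - 2)"
    by (intro power_mult_commuting commute_mult e_comm[symmetric])
  also have "e ^ Suc k = e" for k
    by (induction k) (simp_all add: e_facts)
  then have "e ^ 2 ^ (n - 2) = e"
    by (metis gr0_implies_Suc zero_less_numeral zero_less_power)
  finally show ?thesis by (simp add: e_facts)
qed

text \<open>The commutator is \<open>z x (1 - z * z)\<close>, and \<open>1 - z * z\<close> is 2 on
  \<open>e\<close>. As a multiple of a commutator, \<open>e\<close> vanishes wherever the algebra
  acts commutatively.\<close>

lemma e_commutator: "e = sc (1 / 2) * (x' * (z' * e)) * (z * x - x * z)"
proof -
  have "(z * x - x * z) * e = e * (z * x - x * z)"
    using commute_mult[OF e_comm(3)[symmetric] e_comm(1)[symmetric]]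
      commute_mult[OF e_comm(1)[symmetric] e_comm(3)[symmetric]]
    by (simp only: left_diff_distrib right_diff_distrib)
  then have "sc (1 / 2) * (x' * (z' * e)) * (z * x - x * z) = sc (1 / 2) * ((x' * (z' * (z * x - x * z))) * e)"
    by (simp only: mult.assoc)
  also have "x' * (z' * (z * x - x * z)) = 1 - z * z"
    by (simp add: right_diff_distrib normal_form)
  also have "(1 - z * z) * e = sc 2 * e"
    by (simp add: left_diff_distrib e_facts mult_2)
  finally show ?thesis
    by (simp flip: mult.assoc sc_mult del: sc_numeral)
qed

lemma mem:
  assumes "subalgebra S" "x \<in> S" "y \<in> S" "z \<in> S" "z' \<in> S"
  shows "e \<in> S" "u \<in> S"
proof -
  show "e \<in> S"
    unfolding e_def by (intro subalgebra_intros[OF assms(1)] avg_mem[OF assms(1)] assms)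
  then show "u \<in> S"
    unfolding u_def v_def c_def \<epsilon>_def by (intro subalgebra_intros[OF assms(1)] assms)
qed

end

section \<open>The rational group algebra of H\<close>

text \<open>Put \<open>P = T ^ 2 ^ k\<close> and \<open>d * d = \<mu>\<close>: either
  \<open>P - d\<close> kills \<open>w\<close>, or it maps \<open>w\<close> to an eigenvector of
  \<open>P\<close> for \<open>- d\<close>; then descend. This works in any dimension, and the last
  clause records that \<open>Q\<close> is a polynomial in \<open>T\<close>.\<close>

lemma eigenvector:
  fixes T :: "'g lend"
  assumes "app (T ^ 2 ^ k) w = (\<lambda>t. \<mu> * w t)" "w \<noteq> (\<lambda>t. 0)"
  shows "\<exists>\<alpha> Q. \<alpha> ^ 2 ^ k = \<mu> \<and> app Q w \<noteq> (\<lambda>t. 0) \<and> app T (app Q w) = (\<lambda>t. \<alpha> * app Q w t) \<and>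
    (\<forall>s. T * s = s * T \<longrightarrow> Q * s = s * Q)"
  using assms
proof (induction k arbitrary: \<mu> w)
  case 0
  then show ?case
    by (intro exI[of _ \<mu>] exI[of _ 1]) simp
next
  case (Suc k)
  define d where "d = csqrt \<mu>"
  have d: "d * d = \<mu>"
    by (simp add: d_def flip: power2_eq_square)
  define P where "P = T ^ 2 ^ k"
  have PP: "app P (app P w) = (\<lambda>t. \<mu> * w t)"
    using Suc.prems(1) by (simp add: P_def mult_2 power_add)
  define w2 where "w2 = app (P - scal d) w"
  show ?case
  proof (cases "w2 = (\<lambda>t. 0)")
    case True
    then have "app (T ^ 2 ^ k) w = (\<lambda>t. d * w t)"
      by (simp add: w2_def fun_eq_iff P_def)
    from Suc.IH[OF this Suc.prems(2)] obtain \<alpha> Q where "\<alpha> ^ 2 ^ k = d" "app Q w \<noteq> (\<lambda>t. 0)"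
      "app T (app Q w) = (\<lambda>t. \<alpha> * app Q w t)" "\<forall>s. T * s = s * T \<longrightarrow> Q * s = s * Q" by blast
    then show ?thesis
      using d by (intro exI[of _ \<alpha>] exI[of _ Q]) (simp add: mult_2 power_add)
  next
    case False
    have "app (T ^ 2 ^ k) w2 = (\<lambda>t. - d * w2 t)"
      unfolding P_def[symmetric] w2_def using PP by (simp add: fun_eq_iff algebra_simps flip: d)
    from Suc.IH[OF this False] obtain \<alpha> Q where Q: "\<alpha> ^ 2 ^ k = - d" "app Q w2 \<noteq> (\<lambda>t. 0)"
      "app T (app Q w2) = (\<lambda>t. \<alpha> * app Q w2 t)" "\<And>s. T * s = s * T \<Longrightarrow> Q * s = s * Q" by blast
    have "(Q * (P - scal d)) * s = s * (Q * (P - scal d))" if "T * s = s * T" for s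
    proof (rule commute_mult[OF Q(4)[OF that]])
      have "P * s = s * P"
        unfolding P_def by (rule power_commuting_commutes[OF that])
      moreover have "scal d * s = s * scal d"
        by (rule lend_eqI) simp
      ultimately show "(P - scal d) * s = s * (P - scal d)"
        by (simp add: left_diff_distrib right_diff_distrib)
    qed
    then show ?thesis
      using Q d by (intro exI[of _ \<alpha>] exI[of _ "Q * (P - scal d)"]) (simp add: w2_def mult_2 power_add)
  qed
qed

text \<open>Since the new eigenvector is obtained by a polynomial in \<open>T\<close>, eigenvalues
  of operators commuting with \<open>T\<close> survive. Iteration diagonalises commuting operators
  simultaneously.\<close>

lemma root_eigenvector:
  fixes T :: "'g lend"
  assumes "T ^ 2 ^ k = 1" "w \<noteq> (\<lambda>t. 0)"
  shows "\<exists>\<alpha> w'. \<alpha> ^ 2 ^ k = 1 \<and> w' \<noteq> (\<lambda>t. 0) \<and> app T w' = (\<lambda>t. \<alpha> * w' t) \<and>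
    (\<forall>s \<beta>. T * s = s * T \<longrightarrow> app s w = (\<lambda>t. \<beta> * w t) \<longrightarrow> app s w' = (\<lambda>t. \<beta> * w' t))"
proof -
  from eigenvector[of T k w 1] assms obtain \<alpha> Q where Q: "\<alpha> ^ 2 ^ k = 1" "app Q w \<noteq> (\<lambda>t. 0)"
    "app T (app Q w) = (\<lambda>t. \<alpha> * app Q w t)" "\<And>s. T * s = s * T \<Longrightarrow> Q * s = s * Q" by auto
  have "app s (app Q w) = (\<lambda>t. \<beta> * app Q w t)" if "T * s = s * T" "app s w = (\<lambda>t. \<beta> * w t)" for s \<beta>
  proof -
    have "app s (app Q w) = app (s * Q) w" by simp
    also have "\<dots> = app (Q * s) w" by (simp only: Q(4)[OF that(1)])
    finally show ?thesis by (simp add: that(2))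
  qed
  then show ?thesis using Q by blast
qed

lemma root_power:
  fixes a :: complex
  assumes "a ^ 2 ^ k = 1" "k \<le> n"
  shows "a ^ 2 ^ n = 1"
proof -
  have "(2::nat) ^ n = 2 ^ k * 2 ^ (n - k)"
    using assms(2) by (simp flip: power_add)
  then show ?thesis by (simp only: power_mult assms(1) power_one)
qed

section \<open>Eigenvalues of the abelian subgroup in modules over H\<close>

locale H_module = gen_rels a a' b b' c c'
  for a a' b b' c c' :: "'g lend" +
  fixes n m l :: nat
  assumes an: "a ^ 2 ^ n = 1" and bm: "b ^ 2 ^ m = a ^ 2 ^ m" and cl: "c ^ 2 ^ l = 1"
    and nml: "n > m" "m > l" "l \<ge> 2"
begin

lemma aa_pow: "(a * a) ^ 2 ^ (n - 1) = 1"
proof -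
  have "(2::nat) ^ n = 2 * 2 ^ (n - 1)"
    using nml by (simp flip: power_Suc)
  then show ?thesis
    using an by (simp add: power_mult power2_eq_square)
qed

lemma c_pow: "c ^ 2 ^ (n - 2) = 1"
proof -
  have "(2::nat) ^ (n - 2) = 2 ^ l * 2 ^ (n - 2 - l)"
    using nml by (simp flip: power_add)
  then show ?thesis
    using cl by (simp add: power_mult)
qed

text \<open>The square of \<open>b * a\<close> is \<open>b * b\<close> times
  \<open>a * a * c\<close>. Raised to the power \<open>2 ^ (n - 2)\<close>, the factor
  \<open>c\<close> disappears because \<open>l \<le> n - 2\<close>, and
  \<open>b ^ 2 ^ (n - 1) = a ^ 2 ^ (n - 1)\<close> because \<open>m \<le> n - 1\<close>; two equal
  powers of \<open>a\<close> multiply to \<open>a ^ 2 ^ n = 1\<close>.\<close>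

lemma ba_pow: "(b * a) ^ 2 ^ (n - 1) = 1"
proof -
  have *: "(2::nat) ^ (n - 1) = 2 * 2 ^ (n - 2)"
    using nml by (simp flip: power_Suc add: Suc_diff_le numeral_eq_Suc)
  have "(b * a) * (b * a) = (b * b) * ((a * a) * c)"
    by (simp add: mult.assoc normal_form)
  then have "(b * a) ^ 2 ^ (n - 1) = ((b * b) * ((a * a) * c)) ^ 2 ^ (n - 2)"
    unfolding * by (simp only: power_mult power2_eq_square)
  also have "\<dots> = (b * b) ^ 2 ^ (n - 2) * ((a * a) * c) ^ 2 ^ (n - 2)"
    by (rule power_mult_commuting) (simp add: mult.assoc normal_form)
  also have "((a * a) * c) ^ 2 ^ (n - 2) = (a * a) ^ 2 ^ (n - 2) * c ^ 2 ^ (n - 2)"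
    by (rule power_mult_commuting) (simp add: mult.assoc normal_form)
  also have "(b * b) ^ 2 ^ (n - 2) = b ^ 2 ^ (n - 1)"
    by (simp only: * power_mult power2_eq_square)
  also have "\<dots> = (a ^ 2 ^ m) ^ 2 ^ (n - 1 - m)"
    using nml by (simp flip: bm power_mult power_add)
  also have "\<dots> = a ^ 2 ^ (n - 1)"
    using nml by (simp flip: power_mult power_add)
  also have "\<dots> = (a * a) ^ 2 ^ (n - 2)"
    by (simp only: * power_mult power2_eq_square)
  also have "(a * a) ^ 2 ^ (n - 2) * ((a * a) ^ 2 ^ (n - 2) * c ^ 2 ^ (n - 2)) = (a * a) ^ 2 ^ (n - 1)"
    unfolding c_pow * by (simp add: mult_2 power_add)
  finally show ?thesis by (simp only: aa_pow)
qed

lemma commuting: "a * a * c = c * (a * a)" "a * a * (b * a) = (b * a) * (a * a)" "c * (b * a) = (b * a) * c"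
  by (simp_all add: mult.assoc normal_form)

lemma common_eigenvector:
  assumes e: "e * e = e" "e \<noteq> 0" "e * (a * a) = (a * a) * e" "e * c = c * e" "e * (b * a) = (b * a) * e"
  obtains v \<alpha> \<zeta> \<tau> where "v \<noteq> (\<lambda>t. 0)" "app e v = v" "app a (app a v) = (\<lambda>t. \<alpha> * v t)"
    "app c v = (\<lambda>t. \<zeta> * v t)" "app b (app a v) = (\<lambda>t. \<tau> * v t)"
    "\<alpha> ^ 2 ^ (n - 1) = 1" "\<zeta> ^ 2 ^ (n - 1) = 1" "\<tau> ^ 2 ^ (n - 1) = 1"
proof -
  obtain w where w: "app e w \<noteq> (\<lambda>t. 0)"
    using e(2) lend_eqI[of e 0] by auto
  \<comment> \<open>Membership in the image of \<open>e\<close> is phrased as eigenvalue 1, so that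
    it is carried along with the other eigenvalues.\<close>
  have e0: "app e (app e w) = (\<lambda>t. 1 * app e w t)"
    by (simp add: e(1) flip: app_ring(6))
  obtain \<alpha> v1 where v1: "\<alpha> ^ 2 ^ (n - 1) = 1" "v1 \<noteq> (\<lambda>t. 0)" "app (a * a) v1 = (\<lambda>t. \<alpha> * v1 t)"
    "\<And>s \<beta>. a * a * s = s * (a * a) \<Longrightarrow> app s (app e w) = (\<lambda>t. \<beta> * app e w t) \<Longrightarrow> app s v1 = (\<lambda>t. \<beta> * v1 t)"
    using root_eigenvector[OF aa_pow w] by blast
  obtain \<zeta> v2 where v2: "\<zeta> ^ 2 ^ (n - 2) = 1" "v2 \<noteq> (\<lambda>t. 0)" "app c v2 = (\<lambda>t. \<zeta> * v2 t)"
    "\<And>s \<beta>. c * s = s * c \<Longrightarrow> app s v1 = (\<lambda>t. \<beta> * v1 t) \<Longrightarrow> app s v2 = (\<lambda>t. \<beta> * v2 t)"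
    using root_eigenvector[OF c_pow v1(2)] by blast
  obtain \<tau> v3 where v3: "\<tau> ^ 2 ^ (n - 1) = 1" "v3 \<noteq> (\<lambda>t. 0)" "app (b * a) v3 = (\<lambda>t. \<tau> * v3 t)"
    "\<And>s \<beta>. b * a * s = s * (b * a) \<Longrightarrow> app s v2 = (\<lambda>t. \<beta> * v2 t) \<Longrightarrow> app s v3 = (\<lambda>t. \<beta> * v3 t)"
    using root_eigenvector[OF ba_pow v2(2)] by blast
  show thesis
  proof (rule that[of v3 \<alpha> \<zeta> \<tau>])
    show "app e v3 = v3"
      using v3(4)[OF e(5)[symmetric] v2(4)[OF e(4)[symmetric] v1(4)[OF e(3)[symmetric] e0]]] by simp
    show "app a (app a v3) = (\<lambda>t. \<alpha> * v3 t)"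
      using v3(4)[OF commuting(2)[symmetric] v2(4)[OF commuting(1)[symmetric] v1(3)]] by simp
    show "app c v3 = (\<lambda>t. \<zeta> * v3 t)"
      by (rule v3(4)[OF commuting(3)[symmetric] v2(3)])
    show "\<zeta> ^ 2 ^ (n - 1) = 1"
      by (rule root_power[OF v2(1)]) simp
  qed (use v1 v3 in simp_all)
qed

text \<open>On a common eigenvector \<open>v\<close> of \<open>a * a\<close>, \<open>c\<close> and \<open>b * a\<close> all eigenvalues are
  \<open>2 ^ (n - 1)\<close>-th roots of unity, and the span of \<open>v\<close> and \<open>a v\<close> is invariant under the
  generators. If \<open>c v = v\<close>, the generators commute on this span, so \<open>p * q - q * p\<close> kills \<open>v\<close>;
  otherwise \<open>u\<close> multiplies \<open>v\<close> by an element of the field of these roots of unity, whose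
  \<open>2 ^ (n - 1)\<close>-th power cannot be \<open>- 1\<close>.\<close>

lemma no_component:
  assumes S: "\<And>T. central_scalars.subalgebra (\<lambda>r::rat. scal (of_rat r)) T \<Longrightarrow> {a, a', b, b', c, c'} \<subseteq> T \<Longrightarrow> S \<subseteq> T"
    and mem: "u \<in> S" "p \<in> S" "q \<in> S"
    and e: "e * e = e" "e = r * (p * q - q * p)" and u: "u ^ 2 ^ (n - 1) = - e"
    and u_comm: "u * a = a * u" "u * b = b * u" "u * c = c * u"
  shows "e = 0"
proof (rule ccontr)
  assume "e \<noteq> 0"
  have e_u: "e = - (u ^ 2 ^ (n - 1))"
    using u by simp
  have eX: "e * s = s * e" if "u * s = s * u" for s
    unfolding e_u using power_commuting_commutes[OF that] by simp
  have uX: "u * (s * t) = s * t * u" if "u * s = s * u" "u * t = t * u" for s t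
    by (rule commute_mult[symmetric]) (simp_all add: that)
  obtain v \<alpha> \<zeta> \<tau> where v: "v \<noteq> (\<lambda>t. 0)" "app e v = v" "app a (app a v) = (\<lambda>t. \<alpha> * v t)"
    "app c v = (\<lambda>t. \<zeta> * v t)" "app b (app a v) = (\<lambda>t. \<tau> * v t)"
    and roots: "\<alpha> ^ 2 ^ (n - 1) = 1" "\<zeta> ^ 2 ^ (n - 1) = 1" "\<tau> ^ 2 ^ (n - 1) = 1"
    by (rule common_eigenvector[OF e(1) \<open>e \<noteq> 0\<close> eX eX eX]) (auto intro: uX u_comm)
  have nz: "\<alpha> \<noteq> 0" "\<zeta> \<noteq> 0" "\<tau> \<noteq> 0"
    using roots by (auto simp: power_0_left)
  define av where "av = app a v"
  have "n - 1 \<ge> 2"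
    using nml by linarith
  then obtain K where K: "root_field (n - 1) K"
    using root_field_exists by blast
  have K_rat: "of_rat r \<in> K" and K_add: "s \<in> K \<Longrightarrow> t \<in> K \<Longrightarrow> s + t \<in> K"
    and K_mult: "s \<in> K \<Longrightarrow> t \<in> K \<Longrightarrow> s * t \<in> K" and K_inv: "s \<in> K \<Longrightarrow> inverse s \<in> K"
    and K_root: "s ^ 2 ^ (n - 1) = 1 \<Longrightarrow> s \<in> K" and K_no: "s \<in> K \<Longrightarrow> s ^ 2 ^ (n - 1) \<noteq> - 1" for s t r
    using K by (auto simp: root_field_def)
  have K_0: "0 \<in> K" and K_1: "1 \<in> K"
    using K_rat[of 0] K_rat[of 1] by simp_all
  \<comment> \<open>The factor in \<open>b v = \<kappa> a v\<close>: from
    \<open>a b = b a c'\<close> one gets that \<open>a b v\<close> is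
    \<open>inverse \<zeta> * \<tau>\<close> times \<open>v\<close>, and applying \<open>a\<close>
    once more turns \<open>a a b v\<close> into \<open>\<alpha>\<close> times
    \<open>b v\<close>.\<close>
  define \<kappa> where "\<kappa> = inverse \<alpha> * inverse \<zeta> * \<tau>"
  note K_mem = K_root[OF roots(1)] K_root[OF roots(2)] K_root[OF roots(3)]
  have \<kappa>: "\<kappa> \<in> K" "\<kappa> \<noteq> 0"
    unfolding \<kappa>_def using nz by (auto intro!: K_mult K_inv K_mem)
  have app_eq: "app s (app t w) = app s' (app t' w)" if "s * t = s' * t'" for s t s' t' w
    using that by (metis app_ring(6))
  have inv_app: "app a' (app a w) = w" "app b' (app b w) = w" "app c' (app c w) = w" for w
    by (metis app_ring(2,6) inv)+
  have c'v: "app c' v = (\<lambda>t. inverse \<zeta> * v t)"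
  proof -
    have "v = app c' (\<lambda>t. \<zeta> * v t)"
      using inv_app(3)[of v] by (simp only: v)
    then have "v = (\<lambda>t. \<zeta> * app c' v t)" by simp
    then have "v t = \<zeta> * app c' v t" for t by metis
    then show ?thesis using nz by (simp add: fun_eq_iff)
  qed
  have cav: "app c av = (\<lambda>t. inverse \<zeta> * av t)"
    unfolding av_def app_eq[OF zx] c'v by simp
  have c'av: "app c' av = (\<lambda>t. \<zeta> * av t)"
    unfolding av_def app_eq[OF z'x] v by simp
  have aav: "app a av = (\<lambda>t. \<alpha> * v t)"
    using v by (simp add: av_def)
  have bav: "app b av = (\<lambda>t. \<tau> * v t)"
    using v by (simp add: av_def)
  have bv: "app b v = (\<lambda>t. \<kappa> * av t)"
  proof -
    have "app a (app b v) = app (b * a) (app c' v)"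
      using xy by (simp flip: app_ring(6) add: mult.assoc)
    also have "\<dots> = (\<lambda>t. inverse \<zeta> * \<tau> * v t)"
      unfolding c'v using v by (simp add: mult.assoc)
    finally have "app a (app a (app b v)) = (\<lambda>t. inverse \<zeta> * \<tau> * av t)"
      by (simp add: av_def)
    moreover have "app a (app a (app b v)) = app b (app a (app a v))"
      using square_central(1) by (simp flip: app_ring(6) add: mult.assoc)
    ultimately have "(\<lambda>t. \<alpha> * app b v t) = (\<lambda>t. inverse \<zeta> * \<tau> * av t)"
      using v by simp
    then have "\<alpha> * app b v t = inverse \<zeta> * \<tau> * av t" for t by metis
    then show ?thesis
      using nz by (simp add: fun_eq_iff \<kappa>_def field_simps)
  qed
  have a'v: "app a' v = (\<lambda>t. inverse \<alpha> * av t)" and a'av: "app a' av = v"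
  proof -
    show "app a' av = v" by (simp add: av_def inv_app)
    have "av = (\<lambda>t. \<alpha> * app a' v t)"
      using inv_app(1)[of av] by (simp add: aav)
    then have "av t = \<alpha> * app a' v t" for t by metis
    then show "app a' v = (\<lambda>t. inverse \<alpha> * av t)"
      using nz by (simp add: fun_eq_iff)
  qed
  have b'v: "app b' v = (\<lambda>t. inverse \<tau> * av t)" and b'av: "app b' av = (\<lambda>t. inverse \<kappa> * v t)"
  proof -
    have "av = (\<lambda>t. \<tau> * app b' v t)"
      using inv_app(2)[of av] by (simp add: bav)
    then have "av t = \<tau> * app b' v t" for t by metis
    then show "app b' v = (\<lambda>t. inverse \<tau> * av t)"
      using nz by (simp add: fun_eq_iff)
    have "v = (\<lambda>t. \<kappa> * app b' av t)"
      using inv_app(2)[of v] by (simp add: bv)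
    then have "v t = \<kappa> * app b' av t" for t by metis
    then show "app b' av = (\<lambda>t. inverse \<kappa> * v t)"
      using \<kappa> by (simp add: fun_eq_iff)
  qed
  interpret rs: central_scalars "\<lambda>r::rat. scal (of_rat r)"
    by (rule lend_scalars) (simp_all add: of_rat_add of_rat_mult)
  show False
  proof (cases "\<zeta> = 1")
    case False
    \<comment> \<open>Operators given on \<open>v\<close> and \<open>a v\<close> by a matrix over
      \<open>K\<close>. They form a subalgebra containing the generators, hence
      \<open>u\<close>.\<close>
    define T where "T = {s. \<exists>p\<in>K. \<exists>q\<in>K. \<exists>p2\<in>K. \<exists>q2\<in>K. app s v = (\<lambda>t. p * v t + q * av t) \<and>
      app s av = (\<lambda>t. p2 * v t + q2 * av t)}"
    have TI: "s \<in> T" if "p \<in> K" "q \<in> K" "p2 \<in> K" "q2 \<in> K" "app s v = (\<lambda>t. p * v t + q * av t)"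
      "app s av = (\<lambda>t. p2 * v t + q2 * av t)" for s p q p2 q2
      using that unfolding T_def by blast
    have "rs.subalgebra T"
      unfolding rs.subalgebra_def
    proof (intro conjI ballI subsetI)
      fix s assume "s \<in> range (\<lambda>r::rat. scal (of_rat r) :: 'g lend)"
      then obtain r :: rat where "s = scal (of_rat r)" by blast
      then show "s \<in> T"
        by (intro TI[OF K_rat[of r] K_0 K_0 K_rat[of r]]) simp_all
    next
      fix s1 s2 assume "s1 \<in> T" "s2 \<in> T"
      then obtain p q p2 q2 f g f2 g2 where
        1: "p \<in> K" "q \<in> K" "p2 \<in> K" "q2 \<in> K" "app s1 v = (\<lambda>t. p * v t + q * av t)"
          "app s1 av = (\<lambda>t. p2 * v t + q2 * av t)" and
        2: "f \<in> K" "g \<in> K" "f2 \<in> K" "g2 \<in> K" "app s2 v = (\<lambda>t. f * v t + g * av t)"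
          "app s2 av = (\<lambda>t. f2 * v t + g2 * av t)"
        unfolding T_def by blast
      show "s1 + s2 \<in> T"
        by (rule TI[of "p + f" "q + g" "p2 + f2" "q2 + g2"])
          (simp_all add: 1 2 K_add fun_eq_iff algebra_simps)
      show "s1 * s2 \<in> T"
        by (rule TI[of "f * p + g * p2" "f * q + g * q2" "f2 * p + g2 * p2" "f2 * q + g2 * q2"])
          (simp_all add: 1 2 K_add K_mult fun_eq_iff algebra_simps)
    qed
    moreover have "{a, a', b, b', c, c'} \<subseteq> T"
    proof -
      have "a \<in> T" by (rule TI[of 0 1 \<alpha> 0]) (simp_all add: K_0 K_1 K_mem aav av_def[symmetric])
      moreover have "a' \<in> T" by (rule TI[of 0 "inverse \<alpha>" 1 0]) (simp_all add: K_0 K_1 K_mem K_inv a'v a'av)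
      moreover have "b \<in> T" by (rule TI[of 0 \<kappa> \<tau> 0]) (simp_all add: K_0 \<kappa> K_mem bv bav)
      moreover have "b' \<in> T" by (rule TI[of 0 "inverse \<tau>" "inverse \<kappa>" 0]) (simp_all add: K_0 \<kappa> K_mem K_inv b'v b'av)
      moreover have "c \<in> T" by (rule TI[of \<zeta> 0 0 "inverse \<zeta>"]) (simp_all add: K_0 K_mem K_inv v cav)
      moreover have "c' \<in> T" by (rule TI[of "inverse \<zeta>" 0 0 \<zeta>]) (simp_all add: K_0 K_mem K_inv c'v c'av)
      ultimately show ?thesis by simp
    qed
    ultimately have "u \<in> T" using S mem by blast
    then obtain p q where pq: "p \<in> K" "app u v = (\<lambda>t. p * v t + q * av t)"
      unfolding T_def by blast
    \<comment> \<open>The operator \<open>b a\<close> has eigenvalue \<open>\<tau>\<close> on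
      \<open>v\<close> and \<open>inverse \<zeta> * \<tau>\<close> on \<open>a v\<close>. These
      differ as \<open>\<zeta> \<noteq> 1\<close>, so \<open>u\<close>, commuting with
      \<open>b a\<close>, maps \<open>v\<close> to a multiple of itself.\<close>
    have "app b (app a (app u v)) = app u (app b (app a v))"
      using u_comm by (metis app_ring(6))
    then have "(\<lambda>t. p * app b av t + q * app b (app a av) t) = (\<lambda>t. \<tau> * app u v t)"
      by (simp add: pq bav flip: av_def)
    then have "p * (\<tau> * v t) + q * (\<alpha> * (\<kappa> * av t)) = \<tau> * (p * v t + q * av t)" for t
      by (simp add: bav aav bv pq) metis
    then have "q * (\<alpha> * (\<kappa> * av t)) = q * (\<tau> * av t)" for t
      by (metis (no_types, opaque_lifting) add_left_cancel distrib_left mult.left_commute)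
    moreover have "\<alpha> * \<kappa> = inverse \<zeta> * \<tau>"
      using nz by (simp add: \<kappa>_def)
    ultimately have "q * av t * (inverse \<zeta> - 1) * \<tau> = 0" for t
      by (auto simp: algebra_simps)
    then have "q * av t = 0" for t
      using False nz by simp
    then have uv: "app u v = (\<lambda>t. p * v t)"
      using pq by (simp add: fun_eq_iff)
    have "app (u ^ k) v = (\<lambda>t. p ^ k * v t)" for k
      by (induction k) (simp_all add: uv, simp add: mult_ac)
    then have "(\<lambda>t. p ^ 2 ^ (n - 1) * v t) = (\<lambda>t. - v t)"
      using arg_cong[OF u, of "\<lambda>s. app s v"] v by simp
    then have "p ^ 2 ^ (n - 1) * v t = - 1 * v t" for t
      by (metis mult_minus1)
    with v(1) have "p ^ 2 ^ (n - 1) = - 1"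
      by (metis mult_right_cancel)
    then show False using K_no pq by blast
  next
    case True
    \<comment> \<open>Operators acting on \<open>v\<close> and \<open>a v\<close> like
      \<open>p + q a\<close> with complex \<open>p\<close> and \<open>q\<close>, where
      \<open>a a\<close> is \<open>\<alpha>\<close>; their actions commute.\<close>
    define T where "T = {s. \<exists>p q. app s v = (\<lambda>t. p * v t + q * av t) \<and> app s av = (\<lambda>t. q * \<alpha> * v t + p * av t)}"
    have TI: "s \<in> T" if "app s v = (\<lambda>t. p * v t + q * av t)"
      "app s av = (\<lambda>t. q * \<alpha> * v t + p * av t)" for s p q
      using that unfolding T_def by blast
    have "rs.subalgebra T"
      unfolding rs.subalgebra_def
    proof (intro conjI ballI subsetI)
      fix s assume "s \<in> range (\<lambda>r::rat. scal (of_rat r) :: 'g lend)"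
      then obtain r :: rat where "s = scal (of_rat r)" by blast
      then show "s \<in> T"
        by (intro TI[of _ "of_rat r" 0]) simp_all
    next
      fix s1 s2 assume "s1 \<in> T" "s2 \<in> T"
      then obtain p q f g where
        1: "app s1 v = (\<lambda>t. p * v t + q * av t)" "app s1 av = (\<lambda>t. q * \<alpha> * v t + p * av t)" and
        2: "app s2 v = (\<lambda>t. f * v t + g * av t)" "app s2 av = (\<lambda>t. g * \<alpha> * v t + f * av t)"
        unfolding T_def by blast
      show "s1 + s2 \<in> T"
        by (rule TI[of _ "p + f" "q + g"]) (simp_all add: 1 2 fun_eq_iff algebra_simps)
      show "s1 * s2 \<in> T"
        by (rule TI[of _ "f * p + g * q * \<alpha>" "f * q + g * p"]) (simp_all add: 1 2 fun_eq_iff algebra_simps)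
    qed
    moreover have "{a, a', b, b', c, c'} \<subseteq> T"
    proof -
      have "a \<in> T" by (rule TI[of _ 0 1]) (simp_all add: aav av_def[symmetric])
      moreover have "a' \<in> T" by (rule TI[of _ 0 "inverse \<alpha>"]) (simp_all add: a'v a'av nz)
      moreover have "b \<in> T" by (rule TI[of _ 0 \<kappa>]) (simp_all add: bv bav \<kappa>_def True nz fun_eq_iff field_simps)
      moreover have "b' \<in> T" by (rule TI[of _ 0 "inverse \<tau>"]) (simp_all add: b'v b'av \<kappa>_def True nz fun_eq_iff field_simps)
      moreover have "c \<in> T" by (rule TI[of _ 1 0]) (simp_all add: v cav True)
      moreover have "c' \<in> T" by (rule TI[of _ 1 0]) (simp_all add: c'v c'av True)
      ultimately show ?thesis by simp
    qed
    ultimately have "p \<in> T" "q \<in> T" using S mem by blast+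
    then obtain f g f2 g2 where
      1: "app p v = (\<lambda>t. f * v t + g * av t)" "app p av = (\<lambda>t. g * \<alpha> * v t + f * av t)" and
      2: "app q v = (\<lambda>t. f2 * v t + g2 * av t)" "app q av = (\<lambda>t. g2 * \<alpha> * v t + f2 * av t)"
      unfolding T_def by blast
    have "app (p * q - q * p) v = (\<lambda>t. 0)"
      by (simp add: 1 2 fun_eq_iff algebra_simps)
    then have "app e v = (\<lambda>t. 0)"
      by (simp add: e(2) del: app_ring(4))
    then show False using v by simp
  qed
qed

end

section \<open>The two-dimensional representation of G\<close>

text \<open>Two by two matrices, acting on functions on the two-element type; \<open>True\<close>
  indexes the first coordinate.\<close>

lift_definition mat2 :: "complex \<Rightarrow> complex \<Rightarrow> complex \<Rightarrow> complex \<Rightarrow> bool lend"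
  is "\<lambda>a b c d p t. if t then a * p True + b * p False else c * p True + d * p False"
  by (auto simp: fun_eq_iff algebra_simps)

lemma mat2_mult: "mat2 a b c d * mat2 a2 b2 c2 d2 =
    mat2 (a * a2 + b * c2) (a * b2 + b * d2) (c * a2 + d * c2) (c * b2 + d * d2)"
  by transfer (auto simp: fun_eq_iff algebra_simps)

lemma scal_mat2: "scal r = mat2 r 0 0 r"
  by transfer (auto simp: fun_eq_iff split: if_splits)

lemma one_mat2: "1 = mat2 1 0 0 1"
  by transfer (auto simp: fun_eq_iff split: if_splits)

lemma scal_power: "scal r ^ k = scal (r ^ k)"
  by (induction k) (auto intro!: lend_eqI simp: mult.assoc)

lemma scal_minus_1: "scal (- 1) = - 1"
  by (rule lend_eqI) simp

lemma scal_0: "scal 0 = 0"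
  by (rule lend_eqI) simp

lemma rep2:
  assumes n: "n \<ge> 4" and m: "m \<ge> 1" and l: "l \<ge> 2"
  obtains x x' y y' z z' :: "bool lend" where "gen_rels x x' y y' z z'"
    "x ^ 2 ^ n = 1" "y ^ 2 ^ m = 1" "z ^ 2 ^ l = 1" "z * z = - 1" "y * y = 1" "(x * x) ^ 2 ^ (n - 2) = - 1"
proof -
  define t where "t = cis (pi / 2 ^ (n - 1))"
  have t: "t ^ 2 ^ (n - 1) = - 1"
    by (simp add: t_def DeMoivre)
  have t0: "t \<noteq> 0"
    by (simp add: t_def)
  \<comment> \<open>With \<open>z\<close> diagonal and \<open>x\<close>, \<open>y\<close>
    antidiagonal, the relation \<open>y * x = x * y * z\<close> forces this value. As
    \<open>n \<ge> 4\<close>, the factor \<open>- \<i>\<close> disappears in the power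
    \<open>2 ^ (n - 2)\<close>, leaving \<open>t ^ 2 ^ (n - 1) = - 1\<close>.\<close>
  define \<rho> where "\<rho> = - \<i> * (t * t)"
  have \<rho>0: "\<rho> \<noteq> 0"
    using t0 by (simp add: \<rho>_def)
  have "(2::nat) ^ (n - 2) = 4 * 2 ^ (n - 4)" and *: "(2::nat) ^ (n - 1) = 2 * 2 ^ (n - 2)"
    using n by (auto simp: le_iff_add power_add)
  then have "(- \<i>) ^ 2 ^ (n - 2) = 1"
    by (simp add: power_mult)
  then have \<rho>: "\<rho> ^ 2 ^ (n - 2) = - 1"
    using t unfolding \<rho>_def power_mult_distrib * by (simp add: power_mult power2_eq_square power_mult_distrib)
  define x x' y z z' where defs: "x = mat2 0 \<rho> 1 0" "x' = mat2 0 1 (1 / \<rho>) 0" "y = mat2 0 t (1 / t) 0"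
    "z = mat2 \<i> 0 0 (- \<i>)" "z' = mat2 (- \<i>) 0 0 \<i>"
  interpret gen_rels x x' y y z z'
    by unfold_locales (use t0 \<rho>0 in \<open>simp_all add: defs mat2_mult one_mat2 \<rho>_def field_simps\<close>)
  have xx: "x * x = scal \<rho>"
    by (simp add: defs mat2_mult scal_mat2)
  have yy: "y * y = 1"
    using t0 by (simp add: defs mat2_mult one_mat2)
  have zz: "z * z = - 1"
    unfolding scal_minus_1[symmetric] by (simp add: defs mat2_mult scal_mat2)
  have xn1: "(x * x) ^ 2 ^ (n - 2) = - 1"
    by (simp add: xx scal_power \<rho> scal_minus_1)
  show thesis
  proof (rule that[OF gen_rels_axioms _ _ _ zz yy xn1])
    have "(2::nat) ^ n = 2 * (2 ^ (n - 2) * 2)"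
      using n by (auto simp: le_iff_add power_add)
    then have "x ^ 2 ^ n = ((x * x) ^ 2 ^ (n - 2)) ^ 2"
      by (simp only: power_mult power2_eq_square)
    then show "x ^ 2 ^ n = 1"
      by (simp add: xn1)
    have "(2::nat) ^ m = 2 * 2 ^ (m - 1)"
      using m by (simp flip: power_Suc)
    then show "y ^ 2 ^ m = 1"
      by (simp add: power_mult power2_eq_square yy)
    have "(2::nat) ^ l = 2 * (2 * 2 ^ (l - 2))"
      using l by (auto simp: le_iff_add power_add)
    then show "z ^ 2 ^ l = 1"
      by (simp only: power_mult power2_eq_square zz) simp
  qed
qed

section \<open>The main result\<close>

lemma fst_avg:
  fixes sc :: "rat \<Rightarrow> 'a::ring_1 \<times> 'b::ring_1"
  assumes "rat_scalars sc" "rat_scalars sc2" "\<And>r. fst (sc r) = sc2 r"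
  shows "fst (rat_scalars.avg sc k t) = rat_scalars.avg sc2 k (fst t)"
proof -
  interpret rat_scalars sc by fact
  interpret B: rat_scalars sc2 by fact
  show ?thesis
    by (simp add: avg_def B.avg_def assms fst_sum)
qed

theorem rational_group_algebras_not_iso:
  assumes nml: "n > m" "m > l" "l \<ge> 2"
  shows "\<not> is_algebra_iso (group_algebra TYPE(rat) (grpG n m l)) (group_algebra TYPE(rat) (grpH n m l))"
proof
  assume "is_algebra_iso (group_algebra TYPE(rat) (grpG n m l)) (group_algebra TYPE(rat) (grpH n m l))"
  then obtain h where h: "h \<in> algebra_iso (group_algebra TYPE(rat) (grpG n m l)) (group_algebra TYPE(rat) (grpH n m l))"
    by (auto simp: is_algebra_iso_def)
  let ?G = "relsG n m l" and ?H = "relsH n m l"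
  have n4: "n \<ge> 4" and m1: "m \<ge> 1" and l1: "l \<ge> 1" using nml by auto
  interpret rG: regular_rep "of_rat :: rat \<Rightarrow> complex" ?G
    by unfold_locales (auto simp: of_rat_add of_rat_mult)
  interpret rH: regular_rep "of_rat :: rat \<Rightarrow> complex" ?H
    by unfold_locales (auto simp: of_rat_add of_rat_mult)
  let ?s = "\<lambda>r::rat. scal (of_rat r)"
  have s2: "central_scalars (?s :: rat \<Rightarrow> bool lend)"
    by (rule lend_scalars) (simp_all add: of_rat_add of_rat_mult)
  obtain x1 x1' y1 y1' z1 z1' :: "bool lend" where r1: "gen_rels x1 x1' y1 y1' z1 z1'"
    "x1 ^ 2 ^ n = 1" "y1 ^ 2 ^ m = 1" "z1 ^ 2 ^ l = 1"
    and comp: "z1 * z1 = - 1" "y1 * y1 = 1" "(x1 * x1) ^ 2 ^ (n - 2) = - 1"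
    by (rule rep2[OF n4 m1 nml(3)]) 
  interpret A: presented_rep ?s ?G "triple x1 y1 z1" "triple x1' y1' z1'"
    by (rule gen_rels.presented_rep_relsG[OF r1(1) s2 r1(2-4)])
  have h_closed: "h p \<in> carrier rH.GA" if "p \<in> carrier rG.GA" for p
    using h that unfolding algebra_iso_def ring_iso_def grpG_eq grpH_eq
    by (auto dest: ring_hom_closed)
  have h_mult: "h (p \<otimes>\<^bsub>rG.GA\<^esub> q) = h p \<otimes>\<^bsub>rH.GA\<^esub> h q"
    and h_add: "h (p \<oplus>\<^bsub>rG.GA\<^esub> q) = h p \<oplus>\<^bsub>rH.GA\<^esub> h q"
    if "p \<in> carrier rG.GA" "q \<in> carrier rG.GA" for p q
    using h that unfolding algebra_iso_def ring_iso_def grpG_eq grpH_eq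
    by (auto dest: ring_hom_mult ring_hom_add)
  have h_one: "h (rG.basis []) = rH.basis []"
    using h unfolding algebra_iso_def ring_iso_def grpG_eq grpH_eq rG.GA_one[symmetric] rH.GA_one[symmetric]
    by (auto dest: ring_hom_one)
  have h_smult: "h (r \<odot>\<^bsub>rG.GA\<^esub> p) = r \<odot>\<^bsub>rH.GA\<^esub> h p" if "p \<in> carrier rG.GA" for p r
    using h that unfolding algebra_iso_def grpG_eq grpH_eq by auto
  have h_bij: "bij_betw h (carrier rG.GA) (carrier rH.GA)"
    using h unfolding algebra_iso_def ring_iso_def grpG_eq grpH_eq by auto
  \<comment> \<open>The regular representation of H pulled back along the supposed isomorphism:
    faithful on the group algebra of G, with the image of the group algebra of H.\<close>
  define L where "L p = rH.lin (h p)" for p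
  have L_mult: "L (p \<otimes>\<^bsub>rG.GA\<^esub> q) = L p * L q" and L_add: "L (p \<oplus>\<^bsub>rG.GA\<^esub> q) = L p + L q"
    if "p \<in> carrier rG.GA" "q \<in> carrier rG.GA" for p q
    by (simp_all add: L_def that h_mult h_add h_closed rH.lin_mult rH.lin_add)
  have L_smult: "L (r \<odot>\<^bsub>rG.GA\<^esub> p) = ?s r * L p" if "p \<in> carrier rG.GA" for p r
    by (simp add: L_def that h_smult h_closed rH.lin_smult)
  have L_inj: "p = q" if "p \<in> carrier rG.GA" "q \<in> carrier rG.GA" "L p = L q" for p q
    using that h_bij rH.inj_lin h_closed unfolding L_def bij_betw_def inj_on_def by blast
  have L_surj: "L ` carrier rG.GA = rH.lin ` carrier rH.GA"
    unfolding L_def image_image[symmetric] using h_bij by (simp add: bij_betw_def)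
  define g where "g w = L (rG.basis w)" for w
  have g_append: "g (u @ v) = g u * g v" for u v
    by (simp add: g_def rG.basis_append L_mult rG.basis_closed)
  have g_Nil: "g [] = 1"
    by (simp add: g_def L_def h_one)
  have g_eq: "word_eq ?G u v \<Longrightarrow> g u = g v" for u v
    unfolding g_def rG.basis_def word_class_eq_iff[symmetric] by simp
  have wev_g: "wev (\<lambda>x. g [(x, True)]) (\<lambda>x. g [(x, False)]) w = g w" for w
  proof (induction w)
    case (Cons p w)
    obtain x e where p: "p = (x, e)" by force
    show ?case
      using Cons g_append[of "[p]" w] by (simp add: p)
  qed (simp add: g_Nil)
  have "presented_rep (?s :: rat \<Rightarrow> gens word set lend) ?G (\<lambda>x. g [(x, True)]) (\<lambda>x. g [(x, False)])"
  proof (rule presented_rep.intro[OF rG.central_scalars_axioms], unfold_locales)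
    show "g [(x, True)] * g [(x, False)] = 1" "g [(x, False)] * g [(x, True)] = 1" for x
      using g_eq[OF word_eq.cancel[of ?G x True]] g_eq[OF word_eq.cancel[of ?G x False]]
        g_append[of "[(x, True)]" "[(x, False)]"] g_append[of "[(x, False)]" "[(x, True)]"]
      by (simp_all add: g_Nil)
    show "wev (\<lambda>x. g [(x, True)]) (\<lambda>x. g [(x, False)]) u = wev (\<lambda>x. g [(x, True)]) (\<lambda>x. g [(x, False)]) v"
      if "(u, v) \<in> ?G" for u v
      unfolding wev_g by (rule g_eq[OF word_eq.rel[OF that]])
  qed
  then have relg: "gen_rels_fun (\<lambda>x. g [(x, True)]) (\<lambda>x. g [(x, False)])"
    "g [(Gx, True)] ^ 2 ^ n = 1" "g [(Gy, True)] ^ 2 ^ m = 1" "g [(Gz, True)] ^ 2 ^ l = 1"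
    unfolding presented_rep_relsG_iff by simp_all
  have relG: "gen_rels_fun (regf ?G) (regf' ?G)" "regf ?G Gx ^ 2 ^ n = 1" "regf ?G Gy ^ 2 ^ m = 1" "regf ?G Gz ^ 2 ^ l = 1"
    using rG.presented_rep_axioms unfolding presented_rep_relsG_iff by simp_all
  have relH: "gen_rels_fun (regf ?H) (regf' ?H)" "regf ?H Gx ^ 2 ^ n = 1" "regf ?H Gy ^ 2 ^ m = regf ?H Gx ^ 2 ^ m"
    "regf ?H Gz ^ 2 ^ l = 1"
    using rH.presented_rep_axioms unfolding presented_rep_relsH_iff by simp_all
  let ?sc = "\<lambda>r::rat. (?s r, (?s r, ?s r)) :: bool lend \<times> gens word set lend \<times> gens word set lend"
  \<comment> \<open>The first component shows that \<open>e\<close> is nonzero and the second, being faithful, that \<open>u\<close> is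
    central in the group algebra of G; the third transports both facts to H.\<close>
  define F where "F p = (A.lin p, (rG.lin p, L p))" for p
  interpret P: rat_scalars ?sc
    unfolding rat_scalars_def
    by unfold_locales
      (simp_all only: rG.sc_add rG.sc_mult A.sc_add A.sc_mult prod_eq_iff fst_mult snd_mult fst_one snd_one fst_conv snd_conv
        fst_add snd_add rG.sc_1 A.sc_1, simp_all only: rG.sc_comm A.sc_comm)
  define S where "S = F ` carrier rG.GA"
  have S: "P.subalgebra S"
    unfolding P.subalgebra_def
  proof (intro conjI ballI)
    have "?sc r \<in> S" for r
    proof -
      have "?sc r = F (r \<odot>\<^bsub>rG.GA\<^esub> rG.basis [])"
        using g_Nil by (simp add: F_def A.lin_smult rG.lin_smult L_smult rG.basis_closed g_def)
      then show ?thesis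
        unfolding S_def using rG.smult_closed[OF rG.basis_closed] by blast
    qed
    then show "range ?sc \<subseteq> S" by blast
    fix s t assume "s \<in> S" "t \<in> S"
    then obtain p q where p: "p \<in> carrier rG.GA" "s = F p" and q: "q \<in> carrier rG.GA" "t = F q"
      unfolding S_def by blast
    have "F p + F q = F (p \<oplus>\<^bsub>rG.GA\<^esub> q)" "F p * F q = F (p \<otimes>\<^bsub>rG.GA\<^esub> q)"
      using p q by (simp_all add: F_def A.lin_add rG.lin_add L_add A.lin_mult rG.lin_mult L_mult)
    then show "s + t \<in> S" "s * t \<in> S"
      unfolding S_def p q using rG.add_closed[OF p(1) q(1)] rG.mult_closed[OF p(1) q(1)] by auto
  qed
  define X X' Y Y' Z Z' where defs: "X = (x1, regf ?G Gx, g [(Gx, True)])" "X' = (x1', regf' ?G Gx, g [(Gx, False)])"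
    "Y = (y1, regf ?G Gy, g [(Gy, True)])" "Y' = (y1', regf' ?G Gy, g [(Gy, False)])"
    "Z = (z1, regf ?G Gz, g [(Gz, True)])" "Z' = (z1', regf' ?G Gz, g [(Gz, False)])"
  have "X = F (rG.basis [(Gx, True)])" "X' = F (rG.basis [(Gx, False)])"
    "Y = F (rG.basis [(Gy, True)])" "Y' = F (rG.basis [(Gy, False)])"
    "Z = F (rG.basis [(Gz, True)])" "Z' = F (rG.basis [(Gz, False)])"
    by (simp_all add: defs F_def g_def)
  then have gens: "X \<in> S" "X' \<in> S" "Y \<in> S" "Y' \<in> S" "Z \<in> S" "Z' \<in> S"
    unfolding S_def using rG.basis_closed by auto
  interpret gen_rels X X' Y Y' Z Z'
    unfolding defs by (intro gen_rels_prod r1 relG relg)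
  interpret rational_rels ?sc X X' Y Y' Z Z' n m l
    by unfold_locales (simp_all add: prod_eq_iff defs relG relg r1 n4 l1[simplified])
  interpret B2: rat_scalars "?s :: rat \<Rightarrow> bool lend"
    unfolding rat_scalars_def by (rule s2)
  \<comment> \<open>In the two-dimensional representation all three averaged elements are 1.\<close>
  have "fst e = 1"
    unfolding e_def by (simp add: fst_avg[OF P.rat_scalars_axioms B2.rat_scalars_axioms] defs comp)
  have "e \<in> S" "u \<in> S"
    by (rule mem[OF S gens(1,3,5,6)])+
  then obtain pe pu where pe: "pe \<in> carrier rG.GA" "e = F pe" and pu: "pu \<in> carrier rG.GA" "u = F pu"
    unfolding S_def by blast
  have L_pe: "L pe \<noteq> 0"
  proof
    let ?zero = "0 \<odot>\<^bsub>rG.GA\<^esub> rG.basis []"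
    assume "L pe = 0"
    then have "L pe = L ?zero"
      by (simp add: L_smult rG.basis_closed scal_0)
    then have "pe = ?zero"
      by (intro L_inj pe rG.smult_closed rG.basis_closed)
    then have "A.lin pe = 0"
      by (simp add: A.lin_smult rG.basis_closed scal_0)
    then show False
      using \<open>fst e = 1\<close> pe by (simp add: F_def)
  qed
  \<comment> \<open>The generators of H are images of unknown elements \<open>q\<close>, so
    commuting with the images of \<open>x\<close>, \<open>y\<close>, \<open>z\<close> must be
    extended to the whole group algebra of G.\<close>
  have comm: "snd (snd u) * L q = L q * snd (snd u)" if q: "q \<in> carrier rG.GA" for q
  proof -
    let ?T = "{s. s * rG.lin pu = rG.lin pu * s}"
    have u1: "fst (snd u) = rG.lin pu"
      by (simp add: pu F_def)
    have inv: "s' * t = t * s'" if "s * s' = 1" "s' * s = 1" "s * t = t * s" for s s' t :: "gens word set lend"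
    proof -
      have "s' * t = s' * (t * s) * s'"
        by (simp add: mult.assoc that)
      also have "\<dots> = s' * s * t * s'"
        by (simp only: mult.assoc flip: that(3))
      finally show ?thesis by (simp add: that)
    qed
    have pr: "fst (snd X) = regf ?G Gx" "fst (snd Y) = regf ?G Gy" "fst (snd Z) = regf ?G Gz"
      by (simp_all add: defs)
    have X1: "regf ?G d * rG.lin pu = rG.lin pu * regf ?G d" for d
      using u_comm[THEN arg_cong, of "\<lambda>t. fst (snd t)"] by (cases d) (simp_all add: u1 pr)
    have "regf' ?G d * rG.lin pu = rG.lin pu * regf' ?G d" for d
      by (rule inv[OF rG.f_f' rG.f'_f X1])
    then have "rG.lin q \<in> ?T"
      by (intro rG.lin_in_subalgebra[OF rG.subalgebra_commutant _ _ q]) (simp_all add: X1)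
    then have "rG.lin (q \<otimes>\<^bsub>rG.GA\<^esub> pu) = rG.lin (pu \<otimes>\<^bsub>rG.GA\<^esub> q)"
      by (simp add: rG.lin_mult q pu(1))
    then have "q \<otimes>\<^bsub>rG.GA\<^esub> pu = pu \<otimes>\<^bsub>rG.GA\<^esub> q"
      by (intro inj_onD[OF rG.inj_lin]) (simp_all add: rG.mult_closed q pu(1))
    then have "L q * L pu = L pu * L q"
      by (metis L_mult q pu(1))
    then show ?thesis
      by (simp add: pu(2) F_def)
  qed
  interpret H: H_module "regf ?H Gx" "regf' ?H Gx" "regf ?H Gy" "regf' ?H Gy" "regf ?H Gz" "regf' ?H Gz" n m l
    unfolding H_module_def H_module_axioms_def using relH nml by simp
  have "snd (snd e) = 0"
  proof (rule H.no_component)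
    show "rH.lin ` carrier rH.GA \<subseteq> T" if T: "central_scalars.subalgebra (\<lambda>r::rat. scal (of_rat r)) T"
      "{regf ?H Gx, regf' ?H Gx, regf ?H Gy, regf' ?H Gy, regf ?H Gz, regf' ?H Gz} \<subseteq> T" for T
    proof
      fix s assume "s \<in> rH.lin ` carrier rH.GA"
      then obtain p where p: "p \<in> carrier rH.GA" "s = rH.lin p" by blast
      have "regf ?H d \<in> T" "regf' ?H d \<in> T" for d
        using T(2) by (cases d; simp)+
      then show "s \<in> T"
        unfolding p(2) by (intro rH.lin_in_subalgebra[OF T(1) _ _ p(1)])
    qed
    show "snd (snd u) \<in> rH.lin ` carrier rH.GA"
      unfolding L_surj[symmetric] pu(2) F_def using pu(1) by simp
    show "snd (snd Z) \<in> rH.lin ` carrier rH.GA" "snd (snd X) \<in> rH.lin ` carrier rH.GA"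
      unfolding L_surj[symmetric] defs g_def using rG.basis_closed by simp_all
    show "snd (snd e) * snd (snd e) = snd (snd e)"
      using arg_cong[OF e_facts(1), of "\<lambda>t. snd (snd t)"] by simp
    show "snd (snd e) = snd (snd (?sc (1 / 2) * (X' * (Z' * e)))) * (snd (snd Z) * snd (snd X) - snd (snd X) * snd (snd Z))"
      using arg_cong[OF e_commutator, of "\<lambda>t. snd (snd t)"] by simp
    show "snd (snd u) ^ 2 ^ (n - 1) = - snd (snd e)"
      using arg_cong[OF u_power, of "\<lambda>t. snd (snd t)"] by simp
    \<comment> \<open>Surjectivity of \<open>h\<close> presents each generator of H as some
      \<open>L q\<close>.\<close>
    have uH: "snd (snd u) * regf ?H d = regf ?H d * snd (snd u)" for d
    proof -
      have "regf ?H d \<in> L ` carrier rG.GA"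
        unfolding L_surj by (rule rH.f_in_range_lin)
      then obtain q where "q \<in> carrier rG.GA" "regf ?H d = L q" ..
      then show ?thesis by (simp only: comm)
    qed
    show "snd (snd u) * regf ?H Gx = regf ?H Gx * snd (snd u)"
      "snd (snd u) * regf ?H Gy = regf ?H Gy * snd (snd u)"
      "snd (snd u) * regf ?H Gz = regf ?H Gz * snd (snd u)"
      by (rule uH)+
  qed
  then show False
    using L_pe pe by (simp add: F_def)
qed

theorem proposition4p1:
  fixes n m l :: nat
  assumes "n > m" and "m > l" and "l \<ge> 2"
  shows "is_algebra_iso (group_algebra TYPE(complex) (grpG n m l)) (group_algebra TYPE(complex) (grpH n m l))
       \<and> \<not> is_algebra_iso (group_algebra TYPE(rat) (grpG n m l)) (group_algebra TYPE(rat) (grpH n m l))"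
proof
  show "is_algebra_iso (group_algebra TYPE(complex) (grpG n m l)) (group_algebra TYPE(complex) (grpH n m l))"
    using assms by (intro complex_group_algebras_iso) auto
  show "\<not> is_algebra_iso (group_algebra TYPE(rat) (grpG n m l)) (group_algebra TYPE(rat) (grpH n m l))"
    using assms by (rule rational_group_algebras_not_iso)
qed

end
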